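(* There is an absolute constant $C>0$ such that the following holds. Fix $j\in\mathbb N$ and write $\phi=\phi_j$, $\lambda=\lambda_j$. The function $x\mapsto x\phi'(x)$ (defined almost everywhere in $[0,1]$) is measurable and square integrable on $[0,1]$, and $$\int_0^1\big(x\phi'(x)\big)^2\,dx\le C\,|\lambda|^5(\log|\lambda|)^3.$$
   Context: Let $K:[0,1]\times[0,1]\to\mathbb R$ be defined by $K(x,y)=\frac12-\{(xy)^{-1}\}$ if $0<x,y\le 1$, and $K(x,y)=0$ if $0\le x,y\le1$ and $xy=0$, where $\{\alpha\}=\alpha-\lfloor\alpha\rfloor$. Let $L^2([0,1])$ denote the space of real-valued Lebesgue measurable square-integrable functions on $[0,1]$, with $\langle f,g\rangle=\int_0^1 f(x)g(x)\,dx$ and $\|f\|=\langle f,f\rangle^{1/2}$. A function $\phi$ is an eigenfunction of $K$ (with eigenvalue $\lambda\in\mathbb R$) if $\phi\in L^2([0,1])$, $\|\phi\|>0$, and $\phi(x)=\lambda\int_0^1 K(x,y)\phi(y)\,dy$ for every $x\in[0,1]$. Let $\phi_1,\phi_2,\ldots$ be a maximal orthonormal system in $L^2([0,1])$ of eigenfunctions of $K$, $\phi_j$ having the nonzero real eigenvalue $\lambda_j$, numbered so that $0<|\lambda_1|\le|\lambda_2|\le\cdots$ and $\lambda_j\ge\lambda_{j+1}$ whenever $|\lambda_j|=|\lambda_{j+1}|$. *)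

theory Defs
  imports "HOL-Analysis.Analysis"
begin

definition K :: "real \<Rightarrow> real \<Rightarrow> real" where
  "K x y = (if x * y = 0 then 0 else 1/2 - frac (1 / (x * y)))"

definition L2 :: "(real \<Rightarrow> real) \<Rightarrow> bool" where
  "L2 f \<longleftrightarrow> set_borel_measurable lebesgue {0..1} f
           \<and> set_integrable lebesgue {0..1} (\<lambda>x. (f x)\<^sup>2)"

definition inner01 :: "(real \<Rightarrow> real) \<Rightarrow> (real \<Rightarrow> real) \<Rightarrow> real" where
  "inner01 f g = (LINT x:{0..1}|lebesgue. f x * g x)"

definition norm01 :: "(real \<Rightarrow> real) \<Rightarrow> real" where
  "norm01 f = sqrt (inner01 f f)"

definition eigenfun :: "(real \<Rightarrow> real) \<Rightarrow> real \<Rightarrow> bool" where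
  "eigenfun phi lam \<longleftrightarrow> L2 phi \<and> norm01 phi > 0 \<and>
     (\<forall>x\<in>{0..1}. phi x = lam * (LINT y:{0..1}|lebesgue. K x y * phi y))"

definition eig_system :: "nat set \<Rightarrow> (nat \<Rightarrow> real \<Rightarrow> real) \<Rightarrow> (nat \<Rightarrow> real) \<Rightarrow> bool" where
  "eig_system I phi lam \<longleftrightarrow>
     (I = {1..} \<or> (\<exists>n. I = {1..n})) \<and>
     (\<forall>j\<in>I. lam j \<noteq> 0 \<and> eigenfun (phi j) (lam j)) \<and>
     (\<forall>i\<in>I. \<forall>j\<in>I. inner01 (phi i) (phi j) = (if i = j then 1 else 0)) \<and>
     (\<forall>psi mu. eigenfun psi mu \<and> mu \<noteq> 0 \<and> norm01 psi = 1 \<longrightarrow>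
        \<not> (\<forall>j\<in>I. inner01 psi (phi j) = 0)) \<and>
     (\<forall>j\<in>I. j + 1 \<in> I \<longrightarrow> \<bar>lam j\<bar> \<le> \<bar>lam (j + 1)\<bar>) \<and>
     (\<forall>j\<in>I. j + 1 \<in> I \<longrightarrow> \<bar>lam j\<bar> = \<bar>lam (j + 1)\<bar> \<longrightarrow> lam j \<ge> lam (j + 1))"

end

theory Submission
  imports Defs
begin

text \<open>
  Write \<open>L = \<bar>lam\<bar>\<close>, which is at least 2. As a function of \<open>t = 1 / x \<ge> 1\<close>, the eigenfunction
  \<open>phi\<close> inherits Hoelder continuity of exponent 1/2 from the kernel. Since the sawtooth has mean zero
  over each period, this forces \<open>\<bar>phi x\<bar> \<le> 2 L\<^sup>3 \<surd>x\<close>. The decay at 0 allows termwise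
  differentiation of the floor-function expansion of the eigenfunction equation: for \<open>t\<close> not an
  integer, the derivative of \<open>phi (1 / t)\<close> is \<open>lam H(t)\<close>, where
  \<open>H(t) = (\<Sum>n>t. phi (t / n) / n) - \<integral>phi(y) / y dy\<close> is the error of a Riemann sum of mesh \<open>1 / t\<close>.
  Trivially \<open>H(t) = O(L ln L)\<close>, so \<open>phi (1 / t)\<close> is Lipschitz with constant \<open>O(L\<^sup>2 ln L)\<close>; feeding this
  back into the Riemann sum gives \<open>H(t) = O(L\<^sup>2 ln L (ln L + ln t) / t)\<close>. Splitting the integral of
  \<open>(x phi'(x))\<^sup>2\<close> at \<open>x = 1 / (L ln L)\<close> and using the first bound to the right and the second to the left
  balances both parts at \<open>L\<^sup>5 (ln L)\<^sup>3\<close>.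
\<close>

section \<open>The sawtooth and its modulus of continuity in mean\<close>

text \<open>Off the axes \<open>K x y = saw (1 / (x * y))\<close>, so with \<open>t = 1 / x\<close>
  the kernel becomes \<open>saw (t / y)\<close>.\<close>

definition saw :: "real \<Rightarrow> real" where
  "saw u = 1/2 - frac u"

lemma abs_saw_le: "\<bar>saw u\<bar> \<le> 1/2"
  unfolding saw_def using frac_ge_0[of u] frac_lt_1[of u] by linarith

lemma saw_eq: "real n \<le> u \<Longrightarrow> u < real n + 1 \<Longrightarrow> saw u = real n + 1/2 - u"
proof -
  assume "real n \<le> u" "u < real n + 1"
  then have "\<lfloor>u\<rfloor> = int n" by (simp add: floor_eq_iff)
  then show ?thesis by (simp add: saw_def frac_def)
qed

lemma borel_measurable_saw [measurable]: "saw \<in> borel_measurable borel"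
  unfolding saw_def frac_def by measurable

lemma saw_divide_measurable: "(\<lambda>y. saw (t / y)) \<in> borel_measurable (lebesgue_on S)"
proof -
  have "(\<lambda>y. saw (t / y)) \<in> borel_measurable borel" by measurable
  then have "(\<lambda>y. saw (t / y)) \<in> borel_measurable lebesgue"
    by (intro measurable_completion) simp
  then show ?thesis by (rule measurable_restrict_space1)
qed

lemma saw_diff_integrable:
  "(\<lambda>y. \<bar>saw (a / y) - saw (b / y)\<bar>) integrable_on {0..1}"
proof (rule measurable_bounded_by_integrable_imp_integrable)
  show "(\<lambda>y. \<bar>saw (a / y) - saw (b / y)\<bar>) \<in> borel_measurable (lebesgue_on {0..1})"
    using saw_divide_measurable by measurable
  show "norm \<bar>saw (a / y) - saw (b / y)\<bar> \<le> 1" for y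
    using abs_saw_le[of "a / y"] abs_saw_le[of "b / y"] by auto
qed auto

lemma integral_indicator_interval_le:
  fixes u v :: real
  assumes "u \<le> v"
  shows "integral {0..1} (indicator {u..v} :: real \<Rightarrow> real) \<le> v - u"
    and "(indicator {u..v} :: real \<Rightarrow> real) integrable_on {0..1}"
proof -
  have m: "{u..v} \<inter> {0..1} \<in> lmeasurable"
    by (intro bounded_set_imp_lmeasurable) (auto simp: bounded_Int)
  have "integral {0..1} (indicator {u..v} :: real \<Rightarrow> real) = measure lebesgue ({u..v} \<inter> {0..1})"
    by (rule integral_indicator[OF m])
  also have "\<dots> \<le> measure lebesgue {u..v}"
    by (rule measure_mono_fmeasurable) (use m in auto)
  also have "\<dots> = v - u" using assms by simp
  finally show "integral {0..1} (indicator {u..v} :: real \<Rightarrow> real) \<le> v - u" .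
  show "(indicator {u..v} :: real \<Rightarrow> real) integrable_on {0..1}"
    using m integrable_on_indicator by blast
qed

text \<open>Where \<open>a / y\<close> and \<open>b / y\<close> have the same floor, the two values
  differ by \<open>(b - a) / y\<close>; otherwise an integer \<open>n\<close> lies between them,
  which puts \<open>y\<close> into the short interval \<open>[a / n, b / n]\<close>. Cutting off
  \<open>y <= sqrt (b - a)\<close>, where the difference is at most 1, leaves few such
  \<open>n\<close>, and each part costs a multiple of \<open>sqrt (b - a)\<close>.\<close>

lemma integral_abs_saw_diff_le:
  assumes "1 \<le> a" "a \<le> b" "b \<le> a + 1"
  shows "integral {0..1} (\<lambda>y. \<bar>saw (a / y) - saw (b / y)\<bar>) \<le> 4 * sqrt (b - a)"
proof (cases "a = b")
  case True
  then show ?thesis by simp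
next
  case False
  define h where "h = b - a"
  \<comment> \<open>This cutoff balances the discarded length \<open>d\<close> against the bound
    \<open>h / d\<close> for \<open>h / y\<close> beyond it.\<close>
  define d where "d = sqrt h"
  have h: "0 < h" "h \<le> 1" using assms False by (auto simp: h_def)
  have d: "0 < d" "d \<le> 1" "d * d = h" using h by (auto simp: d_def)
  \<comment> \<open>From \<open>y <= 1\<close> comes \<open>n >= a\<close>, and from
    \<open>y > d\<close> comes \<open>n <= b / d\<close>, so only finitely many jumps
    matter.\<close>
  define N where "N = {n::nat. 1 \<le> n \<and> a \<le> real n \<and> real n \<le> b / d}"
  have subN: "N \<subseteq> {1..nat \<lfloor>b / d\<rfloor>}"
    by (auto simp: N_def le_nat_iff le_floor_iff)
  then have finN: "finite N" using finite_subset by blast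
  have cardN: "real (card N) \<le> b / d"
  proof -
    have "card N \<le> nat \<lfloor>b / d\<rfloor>" using card_mono[OF _ subN] by simp
    also have "real \<dots> \<le> b / d" using assms d by (simp add: of_nat_nat)
    finally show ?thesis by simp
  qed
  define g where "g y = indicator {0..d} y + d + (\<Sum>n\<in>N. indicator {a / real n..b / real n} y)" for y :: real
  have pt: "\<bar>saw (a / y) - saw (b / y)\<bar> \<le> g y" if y: "y \<in> {0..1}" for y
  proof -
    have s1: "\<bar>saw (a / y) - saw (b / y)\<bar> \<le> 1"
      using abs_saw_le[of "a / y"] abs_saw_le[of "b / y"] by auto
    have nn: "0 \<le> (\<Sum>n\<in>N. indicator {a / real n..b / real n} y :: real)"
      by (intro sum_nonneg) auto
    show ?thesis
    proof (cases "y \<le> d")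
      case True
      then show ?thesis using y s1 nn d by (auto simp: g_def)
    next
      case yd: False
      then have y0: "y > 0" using d by auto
      show ?thesis
      proof (cases "\<lfloor>a / y\<rfloor> = \<lfloor>b / y\<rfloor>")
        case True
        then have "\<bar>saw (a / y) - saw (b / y)\<bar> = h / y"
          using y0 h by (simp add: saw_def frac_def h_def diff_divide_distrib[symmetric])
        also have "\<dots> \<le> h / d" using yd d h by (intro divide_left_mono) auto
        also have "\<dots> = d" using d by (simp add: field_simps)
        finally show ?thesis using nn by (auto simp: g_def indicator_def)
      next
        case False
        define n where "n = nat \<lfloor>b / y\<rfloor>"
        have le: "a / y \<le> b / y" using assms y0 by (simp add: divide_right_mono)
        then have "\<lfloor>a / y\<rfloor> < \<lfloor>b / y\<rfloor>" using False floor_mono[OF le] by linarith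
        moreover have by0: "0 \<le> \<lfloor>b / y\<rfloor>" using assms y0 by simp
        then have n: "real n = of_int \<lfloor>b / y\<rfloor>" by (simp add: n_def)
        ultimately have n1: "a / y < real n" "real n \<le> b / y"
          by (auto simp: floor_less_iff)
        have "a \<le> a / y" using y y0 assms by (simp add: field_simps mult_left_le)
        then have an: "a \<le> real n" using n1 by linarith
        have "b / y \<le> b / d" using yd d assms by (intro divide_left_mono) auto
        then have nN: "n \<in> N" using n1 an assms by (auto simp: N_def)
        have n0: "real n > 0" using an assms by linarith
        have "y \<in> {a / real n..b / real n}"
          using n1 n0 y0 by (auto simp: field_simps)
        then have "1 \<le> (indicator {a / real n..b / real n} y :: real)" by simp
        also have "\<dots> \<le> (\<Sum>n\<in>N. indicator {a / real n..b / real n} y)"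
          by (rule member_le_sum[OF nN]) (use finN in auto)
        finally show ?thesis using s1 d by (auto simp: g_def indicator_def)
      qed
    qed
  qed
  have iN: "a / real n \<le> b / real n" for n using assms by (simp add: divide_right_mono)
  have gi1: "(\<lambda>y. \<Sum>n\<in>N. indicator {a / real n..b / real n} y :: real) integrable_on {0..1}"
    by (intro integrable_sum finN integral_indicator_interval_le iN)
  have gi2: "(indicator {0..d} :: real \<Rightarrow> real) integrable_on {0..1}"
    using d by (intro integral_indicator_interval_le) auto
  have gi3: "(\<lambda>y. indicator {0..d} y + d) integrable_on {0..1}"
    by (intro integrable_add gi2) auto
  have gi: "g integrable_on {0..1}"
    unfolding g_def by (intro integrable_add gi1 gi3)
  have "integral {0..1} (\<lambda>y. \<bar>saw (a / y) - saw (b / y)\<bar>) \<le> integral {0..1} g"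
    by (intro integral_le saw_diff_integrable gi pt)
  also have "\<dots> = integral {0..1} (\<lambda>y. indicator {0..d} y + d)
      + integral {0..1} (\<lambda>y. \<Sum>n\<in>N. indicator {a / real n..b / real n} y)"
    unfolding g_def by (rule integral_add[OF gi3 gi1])
  also have "integral {0..1} (\<lambda>y. indicator {0..d} y + d) = integral {0..1} (indicator {0..d}) + d"
    by (subst integral_add[OF gi2]) auto
  also have "integral {0..1} (\<lambda>y. \<Sum>n\<in>N. indicator {a / real n..b / real n} y :: real)
      = (\<Sum>n\<in>N. integral {0..1} (indicator {a / real n..b / real n}))"
    by (intro integral_sum finN integral_indicator_interval_le iN)
  also have "\<dots> \<le> (\<Sum>n\<in>N. h / a)"
  proof (rule sum_mono)
    fix n assume "n \<in> N"
    have "integral {0..1} (indicator {a / real n..b / real n} :: real \<Rightarrow> real) \<le> b / real n - a / real n"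
      by (intro integral_indicator_interval_le iN)
    also have "\<dots> = h / real n" by (simp add: h_def diff_divide_distrib)
    also have "\<dots> \<le> h / a" using \<open>n \<in> N\<close> assms h by (intro divide_left_mono) (auto simp: N_def)
    finally show "integral {0..1} (indicator {a / real n..b / real n} :: real \<Rightarrow> real) \<le> h / a" .
  qed
  also have "\<dots> = real (card N) * (h / a)" by simp
  also have "\<dots> \<le> b / d * (h / a)" using cardN h assms by (intro mult_right_mono) auto
  also have "\<dots> = (b / a) * d" using d(1) assms by (simp add: d(3)[symmetric])
  \<comment> \<open>Here \<open>b <= a + 1 <= 2 * a\<close>.\<close>
  also have "\<dots> \<le> 2 * d" using assms d by (intro mult_right_mono) (auto simp: field_simps)
  finally have "integral {0..1} (\<lambda>y. \<bar>saw (a / y) - saw (b / y)\<bar>)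
      \<le> integral {0..1} (indicator {0..d}) + d + 2 * d" by simp
  moreover have "integral {0..1} (indicator {0..d} :: real \<Rightarrow> real) \<le> d"
    using integral_indicator_interval_le(1)[of 0 d] d by simp
  ultimately show ?thesis by (simp add: d_def h_def)
qed

section \<open>A normalized eigenfunction: size and Hoelder continuity in
  \<open>1 / x\<close>\<close>

locale unit_eigenfunction =
  fixes phi :: "real \<Rightarrow> real" and lam :: real
  assumes eigen: "eigenfun phi lam" and unit: "inner01 phi phi = 1"
begin

lemma phi_measurable: "phi \<in> borel_measurable (lebesgue_on {0..1})"
  using eigen unfolding eigenfun_def L2_def set_borel_measurable_def
  by (subst borel_measurable_restrict_space_iff) auto

lemma phi_sq_integral:
  "(\<lambda>x. (phi x)\<^sup>2) integrable_on {0..1}" "integral {0..1} (\<lambda>x. (phi x)\<^sup>2) = 1"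
proof -
  have "set_integrable lebesgue {0..1} (\<lambda>x. (phi x)\<^sup>2)"
    using eigen by (simp add: eigenfun_def L2_def)
  from set_lebesgue_integral_eq_integral[OF this]
  show "(\<lambda>x. (phi x)\<^sup>2) integrable_on {0..1}" "integral {0..1} (\<lambda>x. (phi x)\<^sup>2) = 1"
    using unit by (auto simp: inner01_def power2_eq_square)
qed

lemma phi_abs_integrable: "phi absolutely_integrable_on {0..1}"
proof (rule measurable_bounded_by_integrable_imp_absolutely_integrable[OF phi_measurable])
  show "(\<lambda>x. ((phi x)\<^sup>2 + 1) / 2) integrable_on {0..1}"
    by (intro integrable_on_divide integrable_add phi_sq_integral) auto
  show "norm (phi x) \<le> ((phi x)\<^sup>2 + 1) / 2" for x
    using sum_squares_bound[of "\<bar>phi x\<bar>" 1] by auto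
qed auto

text \<open>Pointwise AM-GM takes the place of Cauchy-Schwarz; as the square integral is 1, nothing
  is lost.\<close>

lemma integral_abs_phi_le: "integral {0..1} (\<lambda>y. \<bar>phi y\<bar>) \<le> 1"
proof -
  have "integral {0..1} (\<lambda>y. \<bar>phi y\<bar>) \<le> integral {0..1} (\<lambda>x. ((phi x)\<^sup>2 + 1) / 2)"
  proof (rule integral_le)
    show "(\<lambda>y. \<bar>phi y\<bar>) integrable_on {0..1}"
      using phi_abs_integrable by (simp add: absolutely_integrable_on_def)
    show "(\<lambda>x. ((phi x)\<^sup>2 + 1) / 2) integrable_on {0..1}"
      by (intro integrable_on_divide integrable_add phi_sq_integral) auto
    show "\<bar>phi x\<bar> \<le> ((phi x)\<^sup>2 + 1) / 2" for x
      using sum_squares_bound[of "\<bar>phi x\<bar>" 1] by auto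
  qed
  also have "\<dots> = (integral {0..1} (\<lambda>x. (phi x)\<^sup>2) + 1) / 2"
    by (subst integral_divide, subst integral_add) (auto intro: phi_sq_integral)
  also have "\<dots> = 1" by (simp add: phi_sq_integral)
  finally show ?thesis .
qed

lemma phi_0: "phi 0 = 0"
  using eigen by (auto simp: eigenfun_def K_def set_lebesgue_integral_def)

lemma saw_phi_abs_integrable: "(\<lambda>y. saw (t / y) * phi y) absolutely_integrable_on {0..1}"
proof (rule absolutely_integrable_bounded_measurable_product_real)
  show "bounded ((\<lambda>y. saw (t / y)) ` {0..1})"
    by (intro boundedI[of _ "1/2"]) (use abs_saw_le in auto)
qed (use phi_abs_integrable saw_divide_measurable in auto)

lemma phi_eq:
  assumes "1 \<le> t"
  shows "phi (1 / t) = lam * integral {0..1} (\<lambda>y. saw (t / y) * phi y)"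
proof -
  have "1 / t \<in> {0..1}" using assms by auto
  then have "phi (1 / t) = lam * (LINT y:{0..1}|lebesgue. K (1 / t) y * phi y)"
    using eigen by (auto simp: eigenfun_def)
  \<comment> \<open>At \<open>y = 0\<close> the factors differ, \<open>K\<close> being 0 and
    \<open>saw (t / 0)\<close> being \<open>1/2\<close>; \<open>phi 0 = 0\<close> makes the products
    agree.\<close>
  also have "(\<lambda>y. K (1 / t) y * phi y) = (\<lambda>y. saw (t / y) * phi y)"
    using assms phi_0 by (auto simp: K_def saw_def fun_eq_iff)
  also have "(LINT y:{0..1}|lebesgue. saw (t / y) * phi y) = integral {0..1} (\<lambda>y. saw (t / y) * phi y)"
    by (rule set_lebesgue_integral_eq_integral(2)[OF saw_phi_abs_integrable])
  finally show ?thesis .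
qed

definition L :: real where "L = \<bar>lam\<bar>"

lemma L_nonneg [simp]: "0 \<le> L"
  by (simp add: L_def)

lemma phi_le:
  assumes "x \<in> {0..1}"
  shows "\<bar>phi x\<bar> \<le> L / 2"
proof (cases "x = 0")
  case True
  then show ?thesis by (simp add: phi_0)
next
  case False
  have "\<bar>integral {0..1} (\<lambda>y. saw (1 / x / y) * phi y)\<bar> \<le> integral {0..1} (\<lambda>y. \<bar>phi y\<bar> / 2)"
    unfolding real_norm_def[symmetric]
  proof (rule integral_norm_bound_integral)
    show "(\<lambda>y. saw (1 / x / y) * phi y) integrable_on {0..1}"
      using saw_phi_abs_integrable set_lebesgue_integral_eq_integral(1) by blast
    show "(\<lambda>y. norm (phi y) / 2) integrable_on {0..1}"
      using phi_abs_integrable by (simp add: absolutely_integrable_on_def)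
    show "norm (saw (1 / x / y) * phi y) \<le> norm (phi y) / 2" for y
      using mult_right_mono[OF abs_saw_le[of "1 / x / y"], of "\<bar>phi y\<bar>"] by (simp add: abs_mult)
  qed
  also have "\<dots> \<le> 1 / 2" using integral_abs_phi_le by simp
  finally have "\<bar>lam * integral {0..1} (\<lambda>y. saw (1 / x / y) * phi y)\<bar> \<le> L * (1 / 2)"
    unfolding abs_mult L_def by (rule mult_left_mono) auto
  then show ?thesis using phi_eq[of "1 / x"] assms False by auto
qed

text \<open>The square integral 1 is at most the bound \<open>L / 2\<close> for \<open>phi\<close>
  times the mean of \<open>\<bar>phi\<bar>\<close>. Later this absorbs lower powers of
  \<open>L\<close> into higher ones and keeps \<open>ln L\<close> positive.\<close>

lemma L_ge_2: "2 \<le> L"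
proof -
  have "1 = integral {0..1} (\<lambda>x. (phi x)\<^sup>2)" by (simp add: phi_sq_integral)
  also have "\<dots> \<le> integral {0..1} (\<lambda>x. L / 2 * \<bar>phi x\<bar>)"
  proof (rule integral_le)
    show "(\<lambda>x. L / 2 * \<bar>phi x\<bar>) integrable_on {0..1}"
      using phi_abs_integrable unfolding absolutely_integrable_on_def
      by (intro integrable_on_mult_right) auto
    show "(phi x)\<^sup>2 \<le> L / 2 * \<bar>phi x\<bar>" if "x \<in> {0..1}" for x
      using mult_right_mono[OF phi_le[OF that], of "\<bar>phi x\<bar>"] by (simp add: power2_eq_square)
  qed (rule phi_sq_integral)
  also have "\<dots> \<le> L / 2 * 1"
    unfolding integral_mult_right by (intro mult_left_mono integral_abs_phi_le) auto
  finally show ?thesis by simp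
qed

text \<open>Subtract the two eigenfunction equations, bound \<open>phi\<close> by
  \<open>L / 2\<close> under the integral, and use the modulus of continuity of the sawtooth in
  mean.\<close>

lemma phi_hoelder:
  assumes "1 \<le> a" "a \<le> b" "b \<le> a + 1"
  shows "\<bar>phi (1 / a) - phi (1 / b)\<bar> \<le> 2 * L\<^sup>2 * sqrt (b - a)"
proof -
  have i: "(\<lambda>y. saw (t / y) * phi y) integrable_on {0..1}" for t
    using saw_phi_abs_integrable set_lebesgue_integral_eq_integral(1) by blast
  have "phi (1 / a) - phi (1 / b)
      = lam * integral {0..1} (\<lambda>y. saw (a / y) * phi y - saw (b / y) * phi y)"
    using assms by (simp add: phi_eq integral_diff[OF i i] right_diff_distrib)
  also have "\<bar>\<dots>\<bar> \<le> L * integral {0..1} (\<lambda>y. L / 2 * \<bar>saw (a / y) - saw (b / y)\<bar>)"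
    unfolding abs_mult[of lam] L_def[symmetric] unfolding real_norm_def[symmetric]
  proof (intro mult_left_mono integral_norm_bound_integral integrable_diff i)
    show "(\<lambda>y. L / 2 * norm (saw (a / y) - saw (b / y))) integrable_on {0..1}"
      unfolding real_norm_def by (intro integrable_on_mult_right saw_diff_integrable)
    show "norm (saw (a / y) * phi y - saw (b / y) * phi y) \<le> L / 2 * norm (saw (a / y) - saw (b / y))"
      if "y \<in> {0..1}" for y
      using mult_right_mono[OF phi_le[OF that], of "\<bar>saw (a / y) - saw (b / y)\<bar>"]
      unfolding left_diff_distrib[symmetric] real_norm_def abs_mult by (simp add: mult.commute)
  qed auto
  also have "\<dots> = L\<^sup>2 / 2 * integral {0..1} (\<lambda>y. \<bar>saw (a / y) - saw (b / y)\<bar>)"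
    by (simp add: power2_eq_square)
  also have "\<dots> \<le> L\<^sup>2 / 2 * (4 * sqrt (b - a))"
    by (intro mult_left_mono integral_abs_saw_diff_le assms) auto
  finally show ?thesis by (simp add: mult_ac)
qed

end

section \<open>Decay at 0 by cancellation over the periods of the sawtooth\<close>

text \<open>In the variable \<open>s = 1 / y\<close> this says that the sawtooth has mean zero over a period.\<close>

lemma saw_over_square_has_integral_0:
  fixes t :: real and k :: nat
  assumes "0 < t" "0 < k"
  shows "((\<lambda>y. (real k + 1/2 - t / y) / y\<^sup>2) has_integral 0) {t / (real k + 1)..t / real k}"
proof -
  \<comment> \<open>This antiderivative takes the same value \<open>- k * (k + 1) / (2 * t)\<close>
    at both ends of the interval.\<close>
  define F where "F y = t / (2 * y\<^sup>2) - (real k + 1/2) / y" for y :: real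
  have uv: "t / (real k + 1) \<le> t / real k" "0 < t / (real k + 1)"
    using assms by (auto intro: divide_left_mono)
  have "((\<lambda>y. (real k + 1/2 - t / y) / y\<^sup>2) has_integral (F (t / real k) - F (t / (real k + 1))))
      {t / (real k + 1)..t / real k}"
  proof (rule fundamental_theorem_of_calculus[OF uv(1)])
    fix y assume "y \<in> {t / (real k + 1)..t / real k}"
    then have y: "0 < y" using uv(2) by (metis atLeastAtMost_iff less_le_trans)
    have "(F has_real_derivative ((real k + 1/2 - t / y) / y\<^sup>2)) (at y)"
      unfolding F_def using y
      by (auto intro!: derivative_eq_intros simp: field_simps power2_eq_square power4_eq_xxxx)
    then show "(F has_vector_derivative ((real k + 1/2 - t / y) / y\<^sup>2)) (at y within {t / (real k + 1)..t / real k})"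
      by (simp add: has_real_derivative_iff_has_vector_derivative has_vector_derivative_at_within)
  qed
  moreover have "F (t / real k) = - (real k * (real k + 1)) / (2 * t)"
    unfolding F_def using assms by (simp add: field_simps power2_eq_square)
  moreover have "F (t / (real k + 1)) = - (real k * (real k + 1)) / (2 * t)"
  proof -
    define c where "c = real k + 1"
    have c: "c > 0" "real k = c - 1" by (auto simp: c_def)
    show ?thesis unfolding F_def c_def[symmetric] c(2) using assms c(1)
      by (simp add: field_simps power2_eq_square)
  qed
  ultimately show ?thesis by simp
qed

context unit_eigenfunction
begin

lemma saw_phi_integrable:
  assumes "0 \<le> u" "v \<le> 1"
  shows "(\<lambda>y. saw (t / y) * phi y) integrable_on {u..v}"
proof (rule integrable_on_subinterval)
  show "(\<lambda>y. saw (t / y) * phi y) integrable_on {0..1}"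
    using saw_phi_abs_integrable set_lebesgue_integral_eq_integral(1) by blast
qed (use assms in auto)

lemma phi_hoelder_sym:
  assumes "1 \<le> a" "1 \<le> b" "\<bar>a - b\<bar> \<le> 1"
  shows "\<bar>phi (1 / a) - phi (1 / b)\<bar> \<le> 2 * L\<^sup>2 * sqrt \<bar>a - b\<bar>"
proof (cases "a \<le> b")
  case True
  then show ?thesis using phi_hoelder[of a b] assms by (auto simp: abs_if)
next
  case False
  then show ?thesis using phi_hoelder[of b a] assms by (auto simp: abs_minus_commute)
qed

text \<open>The trivial bound, without cancellation; it serves for the two ends of
  \<open>[0, 1]\<close> that are not made of complete periods.\<close>

lemma abs_integral_saw_phi_le:
  assumes "0 \<le> u" "u \<le> v" "v \<le> 1"
  shows "\<bar>integral {u..v} (\<lambda>y. saw (t / y) * phi y)\<bar> \<le> L / 4 * (v - u)"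
proof -
  have "norm (integral {u..v} (\<lambda>y. saw (t / y) * phi y)) \<le> L / 4 * measure lborel {u..v}"
  proof (rule has_integral_bound_real[where S = "{}"])
    show "((\<lambda>y. saw (t / y) * phi y) has_integral integral {u..v} (\<lambda>y. saw (t / y) * phi y)) {u..v}"
      using saw_phi_integrable[of u v t] assms integrable_integral by blast
    show "norm (saw (t / y) * phi y) \<le> L / 4" if "y \<in> {u..v} - {}" for y
      using mult_mono[OF abs_saw_le[of "t / y"] phi_le[of y]] assms that
      by (auto simp: abs_mult)
  qed simp_all
  then show ?thesis using assms by simp
qed

text \<open>Since \<open>s y / y^2\<close> integrates to 0 over the period, \<open>phi y\<close> may
  be replaced by \<open>phi y - c / y^2\<close>. The points \<open>1 / y\<close> and
  \<open>1 / v\<close> are within \<open>1 / t\<close> of each other, so Hoelder continuity makes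
  \<open>phi y - phi v\<close> of order \<open>L^2 / sqrt t\<close>, and the weight
  \<open>(v / y)^2\<close> differs from 1 by at most \<open>3 / t\<close>.\<close>

lemma abs_integral_saw_phi_period_le:
  assumes "1 \<le> t" "t \<le> real k"
  shows "\<bar>integral {t / (real k + 1)..t / real k} (\<lambda>y. saw (t / y) * phi y)\<bar>
    \<le> (L\<^sup>2 / sqrt t + 3 * L / (4 * t)) * (t / real k - t / (real k + 1))"
proof -
  define u where "u = t / (real k + 1)"
  define v where "v = t / real k"
  define s where "s y = real k + 1/2 - t / y" for y
  have k: "0 < k" "0 < real k" using assms by (auto intro: gr0I)
  have uv: "0 < u" "u < v" "v \<le> 1" using assms k by (auto simp: u_def v_def field_simps)
  \<comment> \<open>With this choice \<open>c / y^2\<close> agrees with \<open>phi y\<close> at the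
    right end \<open>y = v\<close>.\<close>
  define c where "c = v\<^sup>2 * phi v"
  define I where "I = integral {u..v} (\<lambda>y. saw (t / y) * phi y)"
  have "((\<lambda>y. saw (t / y) * phi y) has_integral I) {u..v}"
    using saw_phi_integrable[of u v t] uv integrable_integral by (auto simp: I_def)
  \<comment> \<open>At \<open>y = u\<close> the quotient \<open>t / y\<close> equals
    \<open>k + 1\<close> and the sawtooth has jumped, while \<open>s\<close> continues the branch
    valid for \<open>y > u\<close>.\<close>
  then have "((\<lambda>y. s y * phi y) has_integral I) {u..v}"
  proof (rule has_integral_spike_finite[of "{u}", rotated 2])
    fix y assume y: "y \<in> {u..v} - {u}"
    then have y': "u < y" "y \<le> v" "0 < y" using uv by auto
    have "real k \<le> t / y" "t / y < real k + 1"
      using y' k by (auto simp: u_def v_def field_simps)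
    then show "s y * phi y = saw (t / y) * phi y" by (simp add: saw_eq s_def)
  qed simp
  moreover have "((\<lambda>y. c * (s y / y\<^sup>2)) has_integral c * 0) {u..v}"
    unfolding u_def v_def s_def
    by (intro has_integral_mult_right saw_over_square_has_integral_0) (use assms k in auto)
  ultimately have hi: "((\<lambda>y. s y * phi y - c * (s y / y\<^sup>2)) has_integral I - c * 0) {u..v}"
    by (rule has_integral_diff)
  have "norm (I - c * 0) \<le> (L\<^sup>2 / sqrt t + 3 * L / (4 * t)) * measure lborel {u..v}"
  proof (rule has_integral_bound_real[OF _ _ hi, where S = "{}"])
    show "0 \<le> L\<^sup>2 / sqrt t + 3 * L / (4 * t)" using assms by auto
    fix y assume y: "y \<in> {u..v} - {}"
    then have y': "u \<le> y" "y \<le> v" "0 < y" "y \<le> 1" using uv by auto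
    have ty: "real k \<le> t / y" "t / y \<le> real k + 1"
      using y' k by (auto simp: u_def v_def field_simps)
    then have s: "\<bar>s y\<bar> \<le> 1/2" unfolding s_def by linarith
    have "\<bar>phi (1 / (1 / y)) - phi (1 / (real k / t))\<bar> \<le> 2 * L\<^sup>2 * sqrt \<bar>1 / y - real k / t\<bar>"
    proof (rule phi_hoelder_sym)
      have "real k / t \<le> 1 / y" "1 / y \<le> (real k + 1) / t"
        using ty y' assms by (auto simp: field_simps)
      then have "0 \<le> 1 / y - real k / t" "1 / y - real k / t \<le> 1 / t" by (auto simp: add_divide_distrib)
      moreover have "1 / t \<le> 1" using assms by simp
      ultimately show "\<bar>1 / y - real k / t\<bar> \<le> 1" by linarith
    qed (use y' assms in auto)
    also have "\<dots> \<le> 2 * L\<^sup>2 * sqrt (1 / t)"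
    proof -
      have "real k / t \<le> 1 / y" "1 / y \<le> (real k + 1) / t"
        using ty y' assms by (auto simp: field_simps)
      then have "\<bar>1 / y - real k / t\<bar> \<le> 1 / t" by (auto simp: add_divide_distrib)
      then show ?thesis by (intro mult_left_mono real_sqrt_le_mono) auto
    qed
    finally have ho: "\<bar>phi y - phi v\<bar> \<le> 2 * L\<^sup>2 / sqrt t"
      by (simp add: v_def real_sqrt_divide)
    have "v / y \<le> (real k + 1) / real k" 
      using ty k y' by (simp add: v_def field_simps)
    then have "(v / y)\<^sup>2 \<le> ((real k + 1) / real k)\<^sup>2"
      using uv y' by (intro power_mono) auto
    also have "\<dots> \<le> 1 + 3 / real k"
    proof -
      have "real k * 1 \<le> real k * real k" using k by (intro mult_left_mono) auto
      then show ?thesis using k by (simp add: field_simps power2_eq_square)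
    qed
    also have "\<dots> \<le> 1 + 3 / t" using assms by (auto intro: divide_left_mono)
    finally have v1: "(v / y)\<^sup>2 - 1 \<le> 3 / t" by simp
    have v0: "0 \<le> (v / y)\<^sup>2 - 1" using y' by simp
    have "s y * phi y - c * (s y / y\<^sup>2) = s y * ((phi y - phi v) - phi v * ((v / y)\<^sup>2 - 1))"
      by (simp add: c_def power_divide algebra_simps)
    also have "norm \<dots> = \<bar>s y\<bar> * \<bar>(phi y - phi v) - phi v * ((v / y)\<^sup>2 - 1)\<bar>"
      by (simp add: abs_mult)
    also have "\<dots> \<le> 1/2 * (2 * L\<^sup>2 / sqrt t + L / 2 * (3 / t))"
    proof (intro mult_mono s)
      have "\<bar>phi v * ((v / y)\<^sup>2 - 1)\<bar> \<le> L / 2 * (3 / t)"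
        unfolding abs_mult using v0 v1 phi_le[of v] uv by (intro mult_mono) auto
      then show "\<bar>(phi y - phi v) - phi v * ((v / y)\<^sup>2 - 1)\<bar> \<le> 2 * L\<^sup>2 / sqrt t + L / 2 * (3 / t)"
        using ho by linarith
    qed auto
    also have "\<dots> = L\<^sup>2 / sqrt t + 3 * L / (4 * t)" by simp
    finally show "norm (s y * phi y - c * (s y / y\<^sup>2)) \<le> L\<^sup>2 / sqrt t + 3 * L / (4 * t)" .
  qed simp
  then show ?thesis using uv by (simp add: I_def u_def v_def)
qed

text \<open>The bound for one period is its length times a factor that depends only on
  \<open>t\<close> and \<open>L\<close>, so the lengths telescope.\<close>

lemma abs_integral_saw_phi_periods_le:
  assumes "1 \<le> t" "t \<le> real k"
  shows "\<bar>integral {t / real (k + j)..t / real k} (\<lambda>y. saw (t / y) * phi y)\<bar>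
    \<le> (L\<^sup>2 / sqrt t + 3 * L / (4 * t)) * (t / real k - t / real (k + j))"
proof (induction j)
  case 0
  then show ?case by simp
next
  case (Suc j)
  have k: "0 < real k" using assms by linarith
  have "integral {t / real (k + Suc j)..t / real (k + j)} (\<lambda>y. saw (t / y) * phi y)
      + integral {t / real (k + j)..t / real k} (\<lambda>y. saw (t / y) * phi y)
      = integral {t / real (k + Suc j)..t / real k} (\<lambda>y. saw (t / y) * phi y)"
  proof (rule Henstock_Kurzweil_Integration.integral_combine)
    show "t / real (k + Suc j) \<le> t / real (k + j)" "t / real (k + j) \<le> t / real k"
      using k assms by (auto intro!: divide_left_mono)
    show "(\<lambda>y. saw (t / y) * phi y) integrable_on {t / real (k + Suc j)..t / real k}"
      using k assms by (intro saw_phi_integrable) auto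
  qed
  moreover have "\<bar>integral {t / real (k + Suc j)..t / real (k + j)} (\<lambda>y. saw (t / y) * phi y)\<bar>
      \<le> (L\<^sup>2 / sqrt t + 3 * L / (4 * t)) * (t / real (k + j) - t / real (k + Suc j))"
    using abs_integral_saw_phi_period_le[of t "k + j"] assms by (simp add: add_ac)
  ultimately show ?case using Suc.IH by (simp only: right_diff_distrib)
qed

text \<open>Complete periods fill \<open>[u, v]\<close> and profit from the cancellation; the ends
  \<open>[0, u]\<close> and \<open>[v, 1]\<close> have length at most \<open>1 / t\<close> each, so
  the trivial bound is enough there.\<close>

lemma phi_decay_inverse:
  assumes "1 \<le> t"
  shows "\<bar>phi (1 / t)\<bar> \<le> 2 * L ^ 3 / sqrt t"
proof -
  let ?f = "\<lambda>y. saw (t / y) * phi y"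
  define k where "k = nat \<lceil>t\<rceil>"
  have k: "t \<le> real k" "real k \<le> t + 1" using assms by (auto simp: k_def)
  \<comment> \<open>Taking \<open>j >= t^2\<close> periods already makes \<open>u <= 1 / t\<close>,
    so no limit in \<open>j\<close> has to be formed.\<close>
  obtain j :: nat where j: "t\<^sup>2 \<le> real j" using real_arch_simple by blast
  define u where "u = t / real (k + j)"
  define v where "v = t / real k"
  have k0: "0 < real k" using k assms by linarith
  have uv: "0 < u" "u \<le> v" "v \<le> 1"
    using k0 k assms by (auto simp: u_def v_def intro: divide_left_mono)
  have u1: "u \<le> 1 / t"
  proof -
    have "t * t \<le> real (k + j)" using j k0 by (simp add: power2_eq_square)
    then show ?thesis using k0 assms by (simp add: u_def field_simps)
  qed
  have v1: "1 - v \<le> 1 / t"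
  proof -
    have "1 - v = (real k - t) / real k" using k0 by (simp add: v_def field_simps)
    also have "\<dots> \<le> 1 / t" using k assms by (intro frac_le) auto
    finally show ?thesis .
  qed
  define B where "B = L\<^sup>2 / sqrt t + 3 * L / (4 * t)"
  have "integral {0..u} ?f + integral {u..1} ?f = integral {0..1} ?f"
    using uv by (intro Henstock_Kurzweil_Integration.integral_combine saw_phi_integrable) auto
  moreover have "integral {u..v} ?f + integral {v..1} ?f = integral {u..1} ?f"
    using uv by (intro Henstock_Kurzweil_Integration.integral_combine saw_phi_integrable) auto
  moreover have "\<bar>integral {0..u} ?f\<bar> \<le> L / 4 * (1 / t)"
    using abs_integral_saw_phi_le[of 0 u t] uv mult_left_mono[OF u1, of "L / 4"] by auto
  moreover have "\<bar>integral {v..1} ?f\<bar> \<le> L / 4 * (1 / t)"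
    using abs_integral_saw_phi_le[of v 1 t] uv mult_left_mono[OF v1, of "L / 4"] by auto
  moreover have "\<bar>integral {u..v} ?f\<bar> \<le> B * 1"
  proof -
    have "\<bar>integral {u..v} ?f\<bar> \<le> B * (v - u)"
      using abs_integral_saw_phi_periods_le[OF assms k(1), of j] by (simp add: B_def u_def v_def)
    also have "\<dots> \<le> B * 1" using uv assms by (intro mult_left_mono) (auto simp: B_def)
    finally show ?thesis .
  qed
  ultimately have "\<bar>integral {0..1} ?f\<bar> \<le> B + L / 2 * (1 / t)" by (simp add: field_simps)
  also have "\<dots> = L\<^sup>2 / sqrt t + 5 / 4 * L * (1 / t)" by (simp add: B_def field_simps)
  also have "\<dots> \<le> L\<^sup>2 / sqrt t + 5 / 4 * L * (1 / sqrt t)"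
  proof -
    have "sqrt t \<le> t" using assms by (intro real_le_lsqrt) (auto simp: self_le_power)
    then have "1 / t \<le> 1 / sqrt t" using assms by (intro divide_left_mono) auto
    then show ?thesis by (intro add_left_mono mult_left_mono) auto
  qed
  also have "\<dots> = (L\<^sup>2 + 5 / 4 * L) / sqrt t" by (simp add: add_divide_distrib)
  also have "\<dots> \<le> (2 * L\<^sup>2) / sqrt t"
    using mult_right_mono[OF L_ge_2, of L] L_ge_2 assms
    by (intro divide_right_mono) (auto simp: power2_eq_square)
  finally have "L * \<bar>integral {0..1} ?f\<bar> \<le> L * (2 * L\<^sup>2 / sqrt t)"
    by (intro mult_left_mono) auto
  then show ?thesis
    using assms by (simp add: phi_eq abs_mult L_def[symmetric] power3_eq_cube power2_eq_square mult_ac)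
qed

lemma phi_decay:
  assumes "x \<in> {0..1}"
  shows "\<bar>phi x\<bar> \<le> 2 * L ^ 3 * sqrt x"
proof (cases "x = 0")
  case True
  then show ?thesis by (simp add: phi_0)
next
  case False
  then show ?thesis using phi_decay_inverse[of "1 / x"] assms by (simp add: real_sqrt_divide)
qed

text \<open>At 0 this is the decay estimate, elsewhere Hoelder continuity in
  \<open>1 / x\<close>.\<close>

lemma phi_continuous: "continuous_on {0..1} phi"
  unfolding continuous_on_def
proof
  fix x :: real assume x: "x \<in> {0..1}"
  show "(phi \<longlongrightarrow> phi x) (at x within {0..1})"
  proof (cases "x = 0")
    case True
    have "((\<lambda>z. phi z - phi x) \<longlongrightarrow> 0) (at x within {0..1})"
    proof (rule Lim_null_comparison)
      show "\<forall>\<^sub>F z in at x within {0..1}. norm (phi z - phi x) \<le> 2 * L ^ 3 * sqrt z"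
        using phi_decay True by (auto simp: eventually_at_filter phi_0 intro!: always_eventually)
      have "((\<lambda>z. 2 * L ^ 3 * sqrt z) \<longlongrightarrow> 2 * L ^ 3 * sqrt x) (at x within {0..1})"
        by (intro tendsto_intros)
      then show "((\<lambda>z. 2 * L ^ 3 * sqrt z) \<longlongrightarrow> 0) (at x within {0..1})"
        using True by simp
    qed
    then show ?thesis by (simp add: LIM_zero_iff)
  next
    case False
    then have x0: "0 < x" using x by auto
    have lim: "((\<lambda>z. 1 / z - 1 / x) \<longlongrightarrow> 1 / x - 1 / x) (at x within {0..1})"
      using x0 by (intro tendsto_intros) auto
    have "((\<lambda>z. phi z - phi x) \<longlongrightarrow> 0) (at x within {0..1})"
    proof (rule Lim_null_comparison)
      have "\<forall>\<^sub>F z in at x within {0..1}. \<bar>1 / z - 1 / x\<bar> < 1"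
        using tendstoD[OF lim, of 1] by (simp add: dist_real_def)
      moreover have "\<forall>\<^sub>F z in at x within {0..1}. 0 < z"
        using x0 order_tendstoD(1)[OF tendsto_ident_at] by blast
      moreover have "\<forall>\<^sub>F z in at x within {0..1}. z \<in> {0..1}"
        by (simp add: eventually_at_filter)
      ultimately show "\<forall>\<^sub>F z in at x within {0..1}. norm (phi z - phi x) \<le> 2 * L\<^sup>2 * sqrt \<bar>1 / z - 1 / x\<bar>"
      proof eventually_elim
        case (elim z)
        then show ?case using phi_hoelder_sym[of "1 / z" "1 / x"] x x0 by auto
      qed
      have "((\<lambda>z. 2 * L\<^sup>2 * sqrt \<bar>1 / z - 1 / x\<bar>) \<longlongrightarrow> 2 * L\<^sup>2 * sqrt \<bar>1 / x - 1 / x\<bar>) (at x within {0..1})"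
        by (intro tendsto_mult tendsto_const tendsto_real_sqrt tendsto_rabs lim)
      then show "((\<lambda>z. 2 * L\<^sup>2 * sqrt \<bar>1 / z - 1 / x\<bar>) \<longlongrightarrow> 0) (at x within {0..1})" by simp
    qed
    then show ?thesis by (simp add: LIM_zero_iff)
  qed
qed

end

section \<open>Expansion of the eigenfunction equation in floor steps and its termwise
  derivative\<close>

text \<open>Comparison with a telescoping series: consecutive values of \<open>6 / sqrt n\<close>
  differ by at least \<open>1 / (n * sqrt n)\<close>. Such series arise because
  \<open>phi (t / n) / n\<close> is of order \<open>n powr (-3/2)\<close> by the decay at 0.\<close>

lemma inverse_three_halves_tail:
  fixes N :: nat
  assumes "1 \<le> N"
  shows "summable (\<lambda>n. 1 / (real (N + n) * sqrt (real (N + n))))"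
    and "(\<Sum>n. 1 / (real (N + n) * sqrt (real (N + n)))) \<le> 6 / sqrt (real N)"
proof -
  define f where "f n = 6 / sqrt (real (N + n))" for n
  have "filterlim (\<lambda>n. sqrt (real (N + n))) at_top sequentially"
    by (intro filterlim_compose[OF sqrt_at_top] filterlim_compose[OF filterlim_real_sequentially]
        filterlim_add_const_nat_at_top[THEN filterlim_cong[THEN iffD1, rotated 3]])
       (auto simp: add.commute)
  then have "f \<longlonglongrightarrow> 0" unfolding f_def by (intro real_tendsto_divide_at_top[of _ 6]) auto
  then have sm: "(\<lambda>n. f n - f (Suc n)) sums (f 0 - 0)" by (rule telescope_sums')
  have le: "1 / (real (N + n) * sqrt (real (N + n))) \<le> f n - f (Suc n)" for n
  proof -
    define x where "x = sqrt (real (N + n))"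
    define y where "y = sqrt (real (N + n) + 1)"
    have xx: "x * x = real (N + n)" "y * y = real (N + n) + 1" by (auto simp: x_def y_def)
    have x1: "1 \<le> x" using assms by (auto simp: x_def)
    have xy: "x < y" by (auto simp: x_def y_def)
    \<comment> \<open>The ratio bound turns \<open>x * y * (y + x)\<close> into at most
      \<open>15 / 4 * x^3\<close>, which the constant 6 covers.\<close>
    have yx: "y \<le> 3 / 2 * x"
    proof (rule power2_le_imp_le)
      have "1 \<le> x * x" using xx assms by simp
      then show "y\<^sup>2 \<le> (3 / 2 * x)\<^sup>2"
        using xx by (simp add: power2_eq_square)
    qed (use x1 in auto)
    have "(y - x) * (y + x) = 1" using xx by (simp add: algebra_simps)
    then have d: "y - x = 1 / (y + x)" using x1 xy by (simp add: field_simps)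
    have "x * y * (y + x) \<le> x * (3 / 2 * x) * (3 / 2 * x + x)"
      using yx x1 xy by (intro mult_mono) auto
    also have "\<dots> = 15 / 4 * (x * x * x)" by simp
    also have "\<dots> \<le> 6 * (x * x * x)" using x1 by (intro mult_right_mono) auto
    finally have b: "x * y * (y + x) \<le> 6 * (x * x * x)" .
    have "1 / (x * x * x) = 6 / (6 * (x * x * x))" by simp
    also have "\<dots> \<le> 6 / (x * y * (y + x))"
      using b x1 xy by (intro divide_left_mono mult_pos_pos) auto
    also have "\<dots> = 6 / x - 6 / y" 
    proof -
      have "6 / x - 6 / y = 6 * (y - x) / (x * y)" using x1 xy by (simp add: field_simps)
      then show ?thesis using d x1 xy by (simp add: field_simps)
    qed
    finally show ?thesis using xx(1) by (simp add: f_def x_def y_def add_ac)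
  qed
  show s: "summable (\<lambda>n. 1 / (real (N + n) * sqrt (real (N + n))))"
    by (rule summable_comparison_test_ev[OF _ sums_summable[OF sm]]) (use le in auto)
  show "(\<Sum>n. 1 / (real (N + n) * sqrt (real (N + n)))) \<le> 6 / sqrt (real N)"
    using suminf_le[OF le s sums_summable[OF sm]] sums_unique[OF sm] by (simp add: f_def)
qed

context unit_eigenfunction
begin

definition D :: real where "D = 2 * L ^ 3"

lemma D_nonneg [simp]: "0 \<le> D"
  by (simp add: D_def)

lemma phi_le_D: "x \<in> {0..1} \<Longrightarrow> \<bar>phi x\<bar> \<le> D * sqrt x"
  using phi_decay by (simp add: D_def)

text \<open>The floor expansion is written in terms of this antiderivative because
  \<open>Phi (t / n)\<close> can be differentiated in \<open>t\<close>, with derivative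
  \<open>phi (t / n) / n\<close>.\<close>

definition Phi :: "real \<Rightarrow> real" where "Phi y = integral {0..y} phi"

lemma phi_integrable: "0 \<le> u \<Longrightarrow> v \<le> 1 \<Longrightarrow> phi integrable_on {u..v}"
  by (intro integrable_continuous_real continuous_on_subset[OF phi_continuous]) auto

lemma integral_phi_eq: "0 \<le> u \<Longrightarrow> u \<le> v \<Longrightarrow> v \<le> 1 \<Longrightarrow> integral {u..v} phi = Phi v - Phi u"
  using Henstock_Kurzweil_Integration.integral_combine[of 0 u v phi] phi_integrable[of 0 v]
  by (simp add: Phi_def)

lemma Phi_deriv:
  assumes "0 < y" "y < 1"
  shows "(Phi has_real_derivative phi y) (at y)"
proof -
  have "(Phi has_real_derivative phi y) (at y within {0..1})"
    unfolding Phi_def using assms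
    by (intro integral_has_real_derivative phi_continuous) auto
  then show ?thesis using assms at_within_interior[of y "{0..1}"] by simp
qed

lemma Phi_le:
  assumes "0 \<le> y" "y \<le> 1"
  shows "\<bar>Phi y\<bar> \<le> D * sqrt y * y"
proof -
  have "norm (Phi y) \<le> D * sqrt y * measure lborel {0..y}"
    unfolding Phi_def
  proof (rule has_integral_bound_real[where S = "{}"])
    show "(phi has_integral integral {0..y} phi) {0..y}"
      using phi_integrable[of 0 y] assms by (simp add: integrable_integral)
    fix z assume z: "z \<in> {0..y} - {}"
    then have "\<bar>phi z\<bar> \<le> D * sqrt z" using assms by (intro phi_le_D) auto
    also have "\<dots> \<le> D * sqrt y" using z by (intro mult_left_mono) auto
    finally show "norm (phi z) \<le> D * sqrt y" by simp
  qed (use assms in auto)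
  then show ?thesis using assms by simp
qed

text \<open>The decay at 0 is essential: it gives the integrable majorant
  \<open>D * y powr (-1/2)\<close>, whereas mere boundedness of \<open>phi\<close> would leave
  \<open>1 / y\<close>.\<close>

lemma phi_over_abs_integrable: "(\<lambda>y. phi y / y) absolutely_integrable_on {0..1}"
proof (rule measurable_bounded_by_integrable_imp_absolutely_integrable)
  have "(\<lambda>y::real. y) \<in> borel_measurable (lebesgue_on {0..1})"
    by (intro measurable_restrict_space1 measurable_completion) simp
  then show "(\<lambda>y. phi y / y) \<in> borel_measurable (lebesgue_on {0..1})"
    by (intro borel_measurable_divide phi_measurable)
  show "(\<lambda>y. D * y powr (-1/2)) integrable_on {0..1}"
    by (intro integrable_on_mult_right integrable_on_powr_from_0) auto
  fix y :: real assume y: "y \<in> {0..1}"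
  show "norm (phi y / y) \<le> D * y powr (-1/2)"
  proof (cases "y = 0")
    case False
    then have "norm (phi y / y) \<le> D * sqrt y / y"
      using y phi_le_D[of y] by (auto intro: divide_right_mono)
    also have "\<dots> = D * y powr (-1/2)"
      using y False by (simp add: powr_minus powr_half_sqrt field_simps)
    finally show ?thesis .
  qed simp
qed auto

lemma phi_over_integrable: "0 \<le> u \<Longrightarrow> v \<le> 1 \<Longrightarrow> (\<lambda>y. phi y / y) integrable_on {u..v}"
  using set_lebesgue_integral_eq_integral(1)[OF phi_over_abs_integrable]
  by (rule integrable_on_subinterval) auto

lemma abs_integral_phi_over_le:
  assumes "0 \<le> c" "c \<le> 1"
  shows "\<bar>integral {0..c} (\<lambda>y. phi y / y)\<bar> \<le> 2 * D * sqrt c"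
proof -
  have hi: "((\<lambda>y. y powr (-1/2)) has_integral (c powr (-1/2 + 1) / (-1/2 + 1))) {0..c}"
    using assms by (intro has_integral_powr_from_0) auto
  have "norm (integral {0..c} (\<lambda>y. phi y / y)) \<le> integral {0..c} (\<lambda>y. D * y powr (-1/2))"
  proof (rule integral_norm_bound_integral)
    show "(\<lambda>y. phi y / y) integrable_on {0..c}" using assms by (intro phi_over_integrable) auto
    show "(\<lambda>y. D * y powr (-1/2)) integrable_on {0..c}"
      using hi by (intro integrable_on_mult_right) (auto simp: has_integral_iff)
    fix y :: real assume y: "y \<in> {0..c}"
    show "norm (phi y / y) \<le> D * y powr (-1/2)"
    proof (cases "y = 0")
      case False
      then have "norm (phi y / y) \<le> D * sqrt y / y"
        using y assms phi_le_D[of y] by (auto intro: divide_right_mono)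
      also have "\<dots> = D * y powr (-1/2)"
        using y False by (simp add: powr_minus powr_half_sqrt field_simps)
      finally show ?thesis .
    qed simp
  qed
  also have "\<dots> = D * (2 * sqrt c)"
    using hi assms by (simp add: has_integral_iff powr_half_sqrt)
  finally show ?thesis by (simp add: mult_ac)
qed

text \<open>This is the integral that the Riemann sum in \<open>H\<close> approximates; it enters as
  the coefficient of \<open>- t\<close> in the floor expansion.\<close>

definition A :: real where "A = integral {0..1} (\<lambda>y. phi y / y)"

text \<open>The hypotheses say that \<open>t / y\<close> stays between \<open>n\<close> and
  \<open>n + 1\<close>, so the sawtooth is \<open>n + 1/2 - t / y\<close>, except possibly at
  \<open>y = u\<close>.\<close>

lemma integral_saw_phi_step:
  assumes "0 < u" "u \<le> v" "v \<le> 1" "v * real n \<le> t" "t \<le> u * (real n + 1)"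
  shows "integral {u..v} (\<lambda>y. saw (t / y) * phi y)
    = (real n + 1/2) * (Phi v - Phi u) - t * integral {u..v} (\<lambda>y. phi y / y)"
proof (rule integral_unique)
  have "((\<lambda>y. (real n + 1/2) * phi y - t * (phi y / y)) has_integral
      (real n + 1/2) * (Phi v - Phi u) - t * integral {u..v} (\<lambda>y. phi y / y)) {u..v}"
    using assms phi_integrable[of u v] phi_over_integrable[of u v] integral_phi_eq[of u v]
    by (intro has_integral_diff has_integral_mult_right) (auto simp: has_integral_iff)
  then show "((\<lambda>y. saw (t / y) * phi y) has_integral
      (real n + 1/2) * (Phi v - Phi u) - t * integral {u..v} (\<lambda>y. phi y / y)) {u..v}"
  proof (rule has_integral_spike_finite[of "{u}", rotated 2])
    fix y assume y: "y \<in> {u..v} - {u}"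
    then have y': "u < y" "y \<le> v" "0 < y" using assms by auto
    have "y * real n \<le> v * real n" using y' by (intro mult_right_mono) auto
    then have 1: "real n \<le> t / y" using assms y' by (simp add: field_simps)
    have "u * (real n + 1) < y * (real n + 1)" using y' by (intro mult_strict_right_mono) auto
    then have "t / y < real n + 1" using assms y' by (simp add: field_simps)
    with 1 show "saw (t / y) * phi y = (real n + 1/2) * phi y - t * (phi y / y)"
      by (simp add: saw_eq algebra_simps)
  qed simp
qed

text \<open>Summation by parts: the weight \<open>n + 1/2\<close> of \<open>Phi v - Phi u\<close>
  grows by 1 each time \<open>y\<close> passes a point \<open>t / n\<close> downwards, so each such
  point contributes one \<open>Phi (t / n)\<close>, and only boundary terms remain besides.\<close>

lemma integral_saw_phi_partial:
  assumes "1 \<le> m" "real m < t" "t < real m + 1"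
  shows "integral {t / real (m + 1 + j)..1} (\<lambda>y. saw (t / y) * phi y)
    = (real m + 1/2) * Phi 1 - t * integral {t / real (m + 1 + j)..1} (\<lambda>y. phi y / y)
      + (\<Sum>n<j. Phi (t / real (m + 1 + n))) - (real (m + j) + 1/2) * Phi (t / real (m + 1 + j))"
proof (induction j)
  case 0
  have "integral {t / real (m + 1)..1} (\<lambda>y. saw (t / y) * phi y)
    = (real m + 1/2) * (Phi 1 - Phi (t / real (m + 1)))
      - t * integral {t / real (m + 1)..1} (\<lambda>y. phi y / y)"
    using assms by (intro integral_saw_phi_step) (auto simp: field_simps)
  then show ?case by (simp add: algebra_simps)
next
  case (Suc j)
  define k where "k = m + 1 + j"
  define u where "u = t / real (k + 1)"
  define v where "v = t / real k"
  have k: "0 < real k" "t < real k" using assms by (auto simp: k_def)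
  have uv: "0 < u" "u \<le> v" "v \<le> 1" using k assms
    by (auto simp: u_def v_def intro!: divide_left_mono)
  have s: "integral {u..v} (\<lambda>y. saw (t / y) * phi y)
    = (real k + 1/2) * (Phi v - Phi u) - t * integral {u..v} (\<lambda>y. phi y / y)"
    by (intro integral_saw_phi_step uv) (use k in \<open>auto simp: u_def v_def field_simps\<close>)
  have c1: "integral {u..v} (\<lambda>y. saw (t / y) * phi y) + integral {v..1} (\<lambda>y. saw (t / y) * phi y)
      = integral {u..1} (\<lambda>y. saw (t / y) * phi y)"
    using uv by (intro Henstock_Kurzweil_Integration.integral_combine saw_phi_integrable) auto
  have c2: "integral {u..v} (\<lambda>y. phi y / y) + integral {v..1} (\<lambda>y. phi y / y)
      = integral {u..1} (\<lambda>y. phi y / y)"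
    using uv by (intro Henstock_Kurzweil_Integration.integral_combine phi_over_integrable) auto
  have IH: "integral {v..1} (\<lambda>y. saw (t / y) * phi y)
    = (real m + 1/2) * Phi 1 - t * integral {v..1} (\<lambda>y. phi y / y)
      + (\<Sum>n<j. Phi (t / real (m + 1 + n))) - (real k - 1/2) * Phi v"
    using Suc.IH by (simp add: v_def k_def add_ac)
  have "integral {u..1} (\<lambda>y. saw (t / y) * phi y)
    = (real m + 1/2) * Phi 1 - t * integral {u..1} (\<lambda>y. phi y / y)
      + ((\<Sum>n<j. Phi (t / real (m + 1 + n))) + Phi v) - (real k + 1/2) * Phi u"
    unfolding c1[symmetric] c2[symmetric] IH s by (simp add: algebra_simps)
  then show ?case by (simp add: u_def v_def k_def add_ac)
qed

lemma tendsto_divide_real_shift: "(\<lambda>j. t / real (k + j)) \<longlonglongrightarrow> 0"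
proof -
  have "(\<lambda>j. t / real (j + k)) \<longlonglongrightarrow> 0"
    by (rule LIMSEQ_ignore_initial_segment[OF lim_const_over_n])
  then show ?thesis by (simp add: add.commute)
qed

text \<open>Let the number of steps tend to infinity. The boundary term at the left end vanishes
  because \<open>Phi y\<close> is of order \<open>y * sqrt y\<close> while its weight is only of
  order \<open>1 / y\<close>.\<close>

lemma Phi_series:
  assumes "1 \<le> m" "real m < t" "t < real m + 1"
  shows "(\<lambda>n. Phi (t / real (m + 1 + n))) sums
    (integral {0..1} (\<lambda>y. saw (t / y) * phi y) - (real m + 1/2) * Phi 1 + t * A)"
proof -
  let ?u = "\<lambda>j. t / real (m + 1 + j)"
  have u: "0 \<le> ?u j" "?u j \<le> 1" for j using assms by auto
  have u0: "?u \<longlonglongrightarrow> 0" by (rule tendsto_divide_real_shift)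
  have lim: "(\<lambda>j. integral {?u j..1} f) \<longlonglongrightarrow> integral {0..1} f"
    if "f integrable_on {0..1}" for f :: "real \<Rightarrow> real"
  proof -
    have "continuous_on {0..1} (\<lambda>x. integral {x..1} f)"
      by (rule indefinite_integral_continuous_1'[OF that])
    then show ?thesis
      by (rule continuous_on_tendsto_compose[OF _ u0]) (use u in auto)
  qed
  have l3: "(\<lambda>j. (real (m + j) + 1/2) * Phi (?u j)) \<longlonglongrightarrow> 0"
  proof (rule Lim_null_comparison)
    have "norm ((real (m + j) + 1/2) * Phi (?u j)) \<le> D * t * sqrt (?u j)" for j
    proof -
      have "norm ((real (m + j) + 1/2) * Phi (?u j)) \<le> real (m + 1 + j) * (D * sqrt (?u j) * ?u j)"
        unfolding real_norm_def abs_mult by (intro mult_mono Phi_le u) auto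
      \<comment> \<open>The factor \<open>m + 1 + j\<close> cancels against the denominator of
        \<open>?u j\<close>, leaving \<open>t\<close>.\<close>
      also have "\<dots> = D * t * sqrt (?u j)" by (simp del: of_nat_add)
      finally show ?thesis .
    qed
    then show "\<forall>\<^sub>F j in sequentially. norm ((real (m + j) + 1/2) * Phi (?u j)) \<le> D * t * sqrt (?u j)"
      by simp
    have "(\<lambda>j. D * t * sqrt (?u j)) \<longlonglongrightarrow> D * t * sqrt 0"
      by (intro tendsto_intros u0)
    then show "(\<lambda>j. D * t * sqrt (?u j)) \<longlonglongrightarrow> 0" by simp
  qed
  have "(\<lambda>j. integral {?u j..1} (\<lambda>y. saw (t / y) * phi y) - (real m + 1/2) * Phi 1
      + t * integral {?u j..1} (\<lambda>y. phi y / y) + (real (m + j) + 1/2) * Phi (?u j)) \<longlonglongrightarrow>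
    integral {0..1} (\<lambda>y. saw (t / y) * phi y) - (real m + 1/2) * Phi 1 + t * A + 0"
    unfolding A_def
    by (intro tendsto_add tendsto_diff tendsto_mult tendsto_const lim l3 saw_phi_integrable phi_over_integrable) auto
  then show ?thesis
    unfolding sums_def integral_saw_phi_partial[OF assms] by simp
qed

text \<open>With \<open>s = 1 / y\<close> the integral \<open>A\<close> is that of
  \<open>phi (1 / s) / s\<close> over \<open>s >= 1\<close>, and the series is its Riemann sum at
  the equally spaced nodes \<open>n / t\<close>. The argument \<open>m\<close> stands for the floor
  of \<open>t\<close>; keeping it separate fixes the index set while \<open>t\<close> varies between
  integers.\<close>

definition H :: "nat \<Rightarrow> real \<Rightarrow> real" where
  "H m t = (\<Sum>n. phi (t / real (m + 1 + n)) / real (m + 1 + n)) - A"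

lemma phi_series_term_le:
  assumes "0 \<le> t" "t \<le> real k" "0 < k"
  shows "\<bar>phi (t / real k) / real k\<bar> \<le> D * sqrt t * (1 / (real k * sqrt (real k)))"
proof -
  have "\<bar>phi (t / real k)\<bar> \<le> D * sqrt (t / real k)" using assms by (intro phi_le_D) auto
  then have "\<bar>phi (t / real k)\<bar> / real k \<le> D * sqrt (t / real k) / real k"
    by (rule divide_right_mono) auto
  then show ?thesis by (simp add: real_sqrt_divide mult_ac)
qed

text \<open>Between consecutive integers the index set of the expansion is fixed and the term with
  \<open>Phi 1\<close> is constant. The differentiated series is dominated uniformly by a multiple
  of \<open>n powr (-3/2)\<close>, and the term \<open>- t * A\<close> yields the \<open>- A\<close>
  in \<open>H\<close>.\<close>

lemma phi_inverse_deriv: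
  assumes "1 \<le> m" "real m < t" "t < real m + 1"
  shows "((\<lambda>t. phi (1 / t)) has_real_derivative lam * H m t) (at t)"
proof -
  define S where "S = {real m<..<real m + 1}"
  have tS: "t \<in> S" "open S" "convex S" using assms by (auto simp: S_def)
  have d: "((\<lambda>t. \<Sum>n. Phi (t / real (m + 1 + n))) has_field_derivative
      (\<Sum>n. phi (t / real (m + 1 + n)) / real (m + 1 + n))) (at t)"
  proof (rule has_field_derivative_series'(2)[OF tS(3) _ _ tS(1)])
    fix n x assume x: "x \<in> S"
    have "((\<lambda>t. Phi (t / real (m + 1 + n))) has_real_derivative
        phi (x / real (m + 1 + n)) * (1 / real (m + 1 + n))) (at x)"
      using x assms
      by (intro DERIV_chain2[OF Phi_deriv] DERIV_cdivide DERIV_ident) (auto simp: S_def)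
    then show "((\<lambda>t. Phi (t / real (m + 1 + n))) has_real_derivative
        phi (x / real (m + 1 + n)) / real (m + 1 + n)) (at x within S)"
      by (simp add: has_field_derivative_at_within)
  next
    show "uniformly_convergent_on S (\<lambda>n x. \<Sum>i<n. phi (x / real (m + 1 + i)) / real (m + 1 + i))"
    proof (rule Weierstrass_m_test')
      show "summable (\<lambda>n. D * sqrt (real (m + 1)) * (1 / (real (m + 1 + n) * sqrt (real (m + 1 + n)))))"
        by (intro summable_mult inverse_three_halves_tail) auto
      fix n x assume x: "x \<in> S"
      have "norm (phi (x / real (m + 1 + n)) / real (m + 1 + n))
          \<le> D * sqrt x * (1 / (real (m + 1 + n) * sqrt (real (m + 1 + n))))"
        unfolding real_norm_def using x by (intro phi_series_term_le) (auto simp: S_def)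
      also have "\<dots> \<le> D * sqrt (real (m + 1)) * (1 / (real (m + 1 + n) * sqrt (real (m + 1 + n))))"
        using x by (intro mult_right_mono mult_left_mono) (auto simp: S_def)
      finally show "norm (phi (x / real (m + 1 + n)) / real (m + 1 + n))
          \<le> D * sqrt (real (m + 1)) * (1 / (real (m + 1 + n) * sqrt (real (m + 1 + n))))" .
    qed
    show "summable (\<lambda>n. Phi (t / real (m + 1 + n)))"
      using Phi_series[OF assms] by (rule sums_summable)
    show "t \<in> interior S" using tS by (simp add: interior_open)
  qed
  have "((\<lambda>t. lam * ((\<Sum>n. Phi (t / real (m + 1 + n))) + (real m + 1/2) * Phi 1 - t * A))
      has_real_derivative lam * H m t) (at t)"
    unfolding H_def by (rule derivative_eq_intros d refl | simp)+
  then show ?thesis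
  proof (rule has_field_derivative_transform_within_open[OF _ tS(2,1)])
    fix x assume "x \<in> S"
    then have x: "real m < x" "x < real m + 1" "1 \<le> x" using assms by (auto simp: S_def)
    show "lam * ((\<Sum>n. Phi (x / real (m + 1 + n))) + (real m + 1/2) * Phi 1 - x * A) = phi (1 / x)"
      using sums_unique[OF Phi_series[OF assms(1) x(1,2)], symmetric] phi_eq[OF x(3)] by simp
  qed
qed

end

section \<open>Bounds for the Riemann sum error and the Lipschitz estimate\<close>

lemma sum_inverse_le_ln:
  fixes m :: nat
  assumes "1 \<le> m"
  shows "(\<Sum>n<j. 1 / real (m + 1 + n)) \<le> ln (real (m + j) / real m)"
proof (induction j)
  case 0
  then show ?case using assms by simp
next
  case (Suc j)
  define k where "k = real (m + j)"
  have k: "1 \<le> k" using assms by (simp add: k_def)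
  have "ln (k / (k + 1)) \<le> k / (k + 1) - 1" using k by (intro ln_le_minus_one) auto
  also have "\<dots> = - (1 / (k + 1))" using k by (simp add: field_simps)
  finally have "1 / (k + 1) \<le> ln (k + 1) - ln k" using k by (simp add: ln_div)
  moreover have "ln ((k + 1) / real m) = ln (k + 1) - ln (real m)"
    "ln (k / real m) = ln k - ln (real m)" using k assms by (simp_all add: ln_div)
  ultimately show ?case using Suc.IH by (simp add: k_def add_ac)
qed

lemma nat_floor_bounds:
  fixes x :: real
  assumes "1 \<le> x" "x \<notin> range real"
  shows "1 \<le> nat \<lfloor>x\<rfloor>" "real (nat \<lfloor>x\<rfloor>) < x" "x < real (nat \<lfloor>x\<rfloor>) + 1"
proof -
  have f: "1 \<le> \<lfloor>x\<rfloor>" using assms by simp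
  then show "1 \<le> nat \<lfloor>x\<rfloor>" by linarith
  have r: "real (nat \<lfloor>x\<rfloor>) = of_int \<lfloor>x\<rfloor>" using f by (intro of_nat_nat) linarith
  show "x < real (nat \<lfloor>x\<rfloor>) + 1" unfolding r by linarith
  have "x \<noteq> real (nat \<lfloor>x\<rfloor>)" using assms(2) by (metis rangeI)
  then show "real (nat \<lfloor>x\<rfloor>) < x" unfolding r by linarith
qed

context unit_eigenfunction
begin

text \<open>The contribution of the \<open>n\<close>-th mesh interval to the Riemann sum error \<open>H\<close>.\<close>

definition err :: "real \<Rightarrow> nat \<Rightarrow> real" where
  "err t n = phi (t / real n) / real n - integral {t / (real n + 1)..t / real n} (\<lambda>y. phi y / y)"

lemma integral_phi_over_split:
  assumes "1 \<le> m" "real m < t" "t < real m + 1"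
  shows "integral {t / real (m + 1 + j)..1} (\<lambda>y. phi y / y)
    = integral {t / real (m + 1)..1} (\<lambda>y. phi y / y)
      + (\<Sum>n<j. integral {t / (real (m + 1 + n) + 1)..t / real (m + 1 + n)} (\<lambda>y. phi y / y))"
proof (induction j)
  case 0
  then show ?case by simp
next
  case (Suc j)
  define k where "k = m + 1 + j"
  have k: "0 < real k" "t < real k" using assms by (auto simp: k_def)
  have "integral {t / (real k + 1)..t / real k} (\<lambda>y. phi y / y) + integral {t / real k..1} (\<lambda>y. phi y / y)
      = integral {t / (real k + 1)..1} (\<lambda>y. phi y / y)"
    using k assms
    by (intro Henstock_Kurzweil_Integration.integral_combine phi_over_integrable)
       (auto intro!: divide_left_mono)
  then show ?case using Suc.IH by (simp add: k_def add_ac)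
qed

text \<open>For \<open>n < N\<close>, with \<open>N\<close> about \<open>t * R\<close>, sum and
  integral are compared one mesh interval at a time; errors \<open>c / n\<close> add up to a
  logarithm. From \<open>N\<close> on, the decay of \<open>phi\<close> bounds the tail of the sum by
  \<open>6 * D / sqrt R\<close> and the rest of the integral by \<open>2 * D / sqrt R\<close>. The
  piece from \<open>t / (m + 1)\<close> to 1, to which no term is assigned, costs
  \<open>L / (2 * t)\<close>. The parameters \<open>c\<close> and \<open>R\<close> stay free because
  the bound is used both before and after the Lipschitz estimate.\<close>

lemma abs_H_le:
  assumes t: "1 \<le> m" "real m < t" "t < real m + 1"
    and c: "0 \<le> c" and err: "\<And>n. m + 1 \<le> n \<Longrightarrow> \<bar>err t n\<bar> \<le> c / real n"
    and R: "2 \<le> R"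
  shows "\<bar>H m t\<bar> \<le> c * ln (4 * R) + L / (2 * t) + 8 * D / sqrt R"
proof -
  have t0: "0 < t" "1 \<le> t" using t by auto
  define N where "N = nat \<lceil>t * R\<rceil>"
  have tR: "2 * t \<le> t * R" using R t0 by simp
  then have N: "t * R \<le> real N" "real N \<le> t * R + 1"
    using t0 by (auto simp: N_def)
  have "real m + 1 \<le> real N" using N(1) tR t by linarith
  then have "m + 1 \<le> N" by linarith
  then obtain j where j: "N = m + 1 + j" using le_Suc_ex by blast
  have N0: "0 < real N" using j by simp
  define q where "q n = phi (t / real (m + 1 + n)) / real (m + 1 + n)" for n
  define f where "f y = phi y / y" for y
  have q_le: "\<bar>q n\<bar> \<le> D * sqrt t * (1 / (real (m + 1 + n) * sqrt (real (m + 1 + n))))" for n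
    unfolding q_def using t by (intro phi_series_term_le) auto
  have sq: "summable q"
  proof (rule summable_comparison_test_ev)
    show "summable (\<lambda>n. D * sqrt t * (1 / (real (m + 1 + n) * sqrt (real (m + 1 + n)))))"
      by (intro summable_mult inverse_three_halves_tail) auto
  qed (use q_le in auto)
  have tail: "\<bar>\<Sum>n. q (n + j)\<bar> \<le> 6 * D * sqrt (t / real N)"
  proof -
    have le: "\<bar>q (n + j)\<bar> \<le> D * sqrt t * (1 / (real (N + n) * sqrt (real (N + n))))" for n
      using q_le[of "n + j"] by (simp add: j add_ac)
    have s: "summable (\<lambda>n. D * sqrt t * (1 / (real (N + n) * sqrt (real (N + n)))))"
      using j by (intro summable_mult inverse_three_halves_tail) auto
    have sa: "summable (\<lambda>n. \<bar>q (n + j)\<bar>)"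
      by (rule summable_comparison_test_ev[OF _ s]) (use le in auto)
    have "\<bar>\<Sum>n. q (n + j)\<bar> \<le> (\<Sum>n. \<bar>q (n + j)\<bar>)" by (rule summable_rabs[OF sa])
    also have "\<dots> \<le> (\<Sum>n. D * sqrt t * (1 / (real (N + n) * sqrt (real (N + n)))))"
      by (rule suminf_le[OF le sa s])
    also have "\<dots> = D * sqrt t * (\<Sum>n. 1 / (real (N + n) * sqrt (real (N + n))))"
      using j by (intro suminf_mult inverse_three_halves_tail) auto
    also have "\<dots> \<le> D * sqrt t * (6 / sqrt (real N))"
      using j t0 by (intro mult_left_mono inverse_three_halves_tail) auto
    finally show ?thesis by (simp add: real_sqrt_divide mult_ac)
  qed
  have tN: "0 \<le> t / real N" "t / real N \<le> 1"
    using j t by auto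
  have A: "A = integral {0..t / real N} f + integral {t / real N..1} f"
    unfolding A_def f_def using tN
    by (intro Henstock_Kurzweil_Integration.integral_combine[symmetric] phi_over_integrable) auto
  have I0: "\<bar>integral {0..t / real N} f\<bar> \<le> 2 * D * sqrt (t / real N)"
    unfolding f_def by (rule abs_integral_phi_over_le[OF tN])
  have I1: "\<bar>integral {t / real (m + 1)..1} f\<bar> \<le> L / (2 * t)"
  proof -
    have u: "0 < t / real (m + 1)" "t / real (m + 1) \<le> 1" using t t0 by auto
    have "norm (integral {t / real (m + 1)..1} f)
        \<le> (L / 2) * (real (m + 1) / t) * measure lborel {t / real (m + 1)..1}"
    proof (rule has_integral_bound_real[where S = "{}"])
      show "(f has_integral integral {t / real (m + 1)..1} f) {t / real (m + 1)..1}"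
        unfolding f_def using u phi_over_integrable[of "t / real (m + 1)" 1]
        by (simp add: integrable_integral)
      fix y assume y: "y \<in> {t / real (m + 1)..1} - {}"
      then have y': "0 < y" "y \<le> 1" using u by auto
      have "1 / y \<le> real (m + 1) / t" using y t0 y' by (simp add: field_simps)
      then have "\<bar>phi y\<bar> * (1 / y) \<le> (L / 2) * (real (m + 1) / t)"
        using y' by (intro mult_mono phi_le) auto
      then show "norm (f y) \<le> (L / 2) * (real (m + 1) / t)"
        using y' by (simp add: f_def)
    qed (use t0 in auto)
    also have "\<dots> = (L / 2) * (real (m + 1) / t * (1 - t / real (m + 1)))"
      using u by (simp del: of_nat_add)
    also have "real (m + 1) / t * (1 - t / real (m + 1)) = (real m + 1 - t) / t"
      using t0 by (simp add: divide_simps)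
    also have "(L / 2) * \<dots> \<le> (L / 2) * (1 / t)"
      using t t0 by (intro mult_left_mono divide_right_mono) auto
    finally show ?thesis by simp
  qed
  have split: "integral {t / real N..1} f = integral {t / real (m + 1)..1} f
      + (\<Sum>n<j. integral {t / (real (m + 1 + n) + 1)..t / real (m + 1 + n)} f)"
    unfolding f_def j by (rule integral_phi_over_split[OF t])
  have "H m t = (\<Sum>n. q (n + j)) + (\<Sum>n<j. q n) - A"
    using suminf_split_initial_segment[OF sq, of j] by (simp only: H_def q_def[symmetric])
  also have "\<dots> = (\<Sum>n. q (n + j)) + (\<Sum>n<j. err t (m + 1 + n))
      - integral {t / real (m + 1)..1} f - integral {0..t / real N} f"
    unfolding A split by (simp add: err_def q_def f_def[abs_def] sum_subtractf)
  finally have Heq: "H m t = (\<Sum>n. q (n + j)) + (\<Sum>n<j. err t (m + 1 + n))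
      - integral {t / real (m + 1)..1} f - integral {0..t / real N} f" .
  have "\<bar>\<Sum>n<j. err t (m + 1 + n)\<bar> \<le> (\<Sum>n<j. \<bar>err t (m + 1 + n)\<bar>)" by (rule sum_abs)
  also have "\<dots> \<le> (\<Sum>n<j. c * (1 / real (m + 1 + n)))"
  proof (rule sum_mono)
    show "\<bar>err t (m + 1 + n)\<bar> \<le> c * (1 / real (m + 1 + n))" for n
      using err[of "m + 1 + n"] by simp
  qed
  also have "\<dots> = c * (\<Sum>n<j. 1 / real (m + 1 + n))" by (simp add: sum_distrib_left)
  also have "\<dots> \<le> c * ln (4 * R)"
  proof (intro mult_left_mono c)
    \<comment> \<open>One factor 2 comes from rounding \<open>t * R\<close> up to \<open>N\<close>,
      the other from \<open>t < m + 1 <= 2 * m\<close>.\<close>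
    have "real (m + j) / real m \<le> 4 * R"
    proof -
      have "1 * 1 \<le> t * R" using t0 R by (intro mult_mono) auto
      then have "real (m + j) \<le> 2 * (t * R)" using N j by linarith
      also have "\<dots> \<le> 2 * ((2 * real m) * R)" using t R by (intro mult_left_mono mult_right_mono) auto
      finally show ?thesis using t by (simp add: field_simps)
    qed
    then have "ln (real (m + j) / real m) \<le> ln (4 * R)"
      using t R by (intro ln_mono) auto
    with sum_inverse_le_ln[OF t(1), of j] show "(\<Sum>n<j. 1 / real (m + 1 + n)) \<le> ln (4 * R)" by linarith
  qed
  finally have S: "\<bar>\<Sum>n<j. err t (m + 1 + n)\<bar> \<le> c * ln (4 * R)" .
  have "t / real N \<le> 1 / R" using N N0 t0 R by (simp add: field_simps)
  then have "sqrt (t / real N) \<le> sqrt (1 / R)" by (rule real_sqrt_le_mono)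
  also have "\<dots> = 1 / sqrt R" by (simp add: real_sqrt_divide)
  finally have "sqrt (t / real N) \<le> 1 / sqrt R" .
  then have "8 * D * sqrt (t / real N) \<le> 8 * D * (1 / sqrt R)" by (intro mult_left_mono) auto
  then show ?thesis using Heq tail I0 I1 S by simp
qed

text \<open>No cancellation is used: the node term and the integral are each at most
  \<open>L / (2 * n)\<close>, the latter because the interval has length
  \<open>t / (n * (n + 1))\<close> and \<open>1 / y <= (n + 1) / t\<close> on it.\<close>

lemma abs_err_le:
  assumes "0 < t" "t \<le> real n"
  shows "\<bar>err t n\<bar> \<le> L / real n"
proof -
  have n: "0 < real n" using assms by linarith
  define u where "u = t / (real n + 1)"
  define v where "v = t / real n"
  have uv: "0 < u" "u \<le> v" "v \<le> 1" using n assms by (auto simp: u_def v_def intro!: divide_left_mono)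
  have "norm (integral {u..v} (\<lambda>y. phi y / y)) \<le> (L / 2) * ((real n + 1) / t) * measure lborel {u..v}"
  proof (rule has_integral_bound_real[where S = "{}"])
    show "((\<lambda>y. phi y / y) has_integral integral {u..v} (\<lambda>y. phi y / y)) {u..v}"
      using uv phi_over_integrable[of u v] by (simp add: integrable_integral)
    fix y assume y: "y \<in> {u..v} - {}"
    then have y': "0 < y" "y \<le> 1" using uv by auto
    have "1 / y \<le> (real n + 1) / t" using y assms y' n by (simp add: u_def field_simps)
    then have "\<bar>phi y\<bar> * (1 / y) \<le> (L / 2) * ((real n + 1) / t)"
      using y' by (intro mult_mono phi_le) auto
    then show "norm (phi y / y) \<le> (L / 2) * ((real n + 1) / t)" using y' by simp
  qed (use assms in auto)
  also have "\<dots> = (L / 2) * ((real n + 1) / t) * (v - u)" using uv by simp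
  also have "v - u = t / (real n * (real n + 1))" using n by (simp add: u_def v_def field_simps)
  also have "(L / 2) * ((real n + 1) / t) * (t / (real n * (real n + 1))) = L / 2 / real n"
    using assms n by (simp add: divide_simps)
  finally have "\<bar>integral {u..v} (\<lambda>y. phi y / y)\<bar> \<le> L / 2 / real n" by simp
  moreover have "\<bar>phi v / real n\<bar> \<le> L / 2 / real n"
  proof -
    have "\<bar>phi v\<bar> / real n \<le> L / 2 / real n" using uv by (intro divide_right_mono phi_le) auto
    then show ?thesis by simp
  qed
  moreover have "L / real n = L / 2 / real n + L / 2 / real n" by simp
  ultimately show ?thesis unfolding err_def u_def v_def by linarith
qed

text \<open>The error is the integral of \<open>phi v * w - phi y / y\<close>. It is small because
  \<open>phi\<close> oscillates by at most \<open>M / t\<close> on the interval and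
  \<open>1 / y\<close> differs from \<open>w\<close> by at most \<open>1 / t\<close>.\<close>

lemma abs_err_le_osc:
  assumes "1 \<le> t" "t \<le> real n" "0 \<le> M"
    and osc: "\<And>y. t / (real n + 1) \<le> y \<Longrightarrow> y \<le> t / real n \<Longrightarrow> \<bar>phi (t / real n) - phi y\<bar> \<le> M / t"
  shows "\<bar>err t n\<bar> \<le> (L + M) / t / real n"
proof -
  have n: "0 < real n" using assms by linarith
  define u where "u = t / (real n + 1)"
  define v where "v = t / real n"
  have uv: "0 < u" "u \<le> v" "v \<le> 1" using n assms by (auto simp: u_def v_def intro!: divide_left_mono)
  have len: "v - u = t / (real n * (real n + 1))" using n by (simp add: u_def v_def field_simps)
  \<comment> \<open>This is \<open>1 / u\<close>, the constant for which \<open>w * (v - u)\<close>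
    is exactly the weight \<open>1 / n\<close> of the node.\<close>
  define w where "w = (real n + 1) / t"
  have "((\<lambda>y. phi v * w - phi y / y) has_integral
      (phi v * w * (v - u) - integral {u..v} (\<lambda>y. phi y / y))) {u..v}"
    using uv phi_over_integrable[of u v] has_integral_const_real[of "phi v * w" u v]
    by (intro has_integral_diff) (auto simp: integrable_integral mult.commute)
  also have "phi v * w * (v - u) = phi v / real n"
    using n assms by (simp add: len w_def)
  finally have hi: "((\<lambda>y. phi v * w - phi y / y) has_integral err t n) {u..v}"
    by (simp add: err_def u_def v_def)
  have "norm (err t n) \<le> ((M / t) * w + (L / 2) * (1 / t)) * measure lborel {u..v}"
  proof (rule has_integral_bound_real[OF _ _ hi, where S = "{}"])
    fix y assume y: "y \<in> {u..v} - {}"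
    then have y': "0 < y" "y \<le> 1" "u \<le> y" "y \<le> v" using uv by auto
    have 1: "1 / y \<le> w" using y assms y' n by (simp add: w_def u_def field_simps)
    have "real n / t \<le> 1 / y" using y assms y' n by (simp add: v_def field_simps)
    then have 2: "w - 1 / y \<le> 1 / t" using assms by (simp add: w_def add_divide_distrib)
    have w0: "0 \<le> w" using assms n by (simp add: w_def)
    have "phi v * w - phi y / y = (phi v - phi y) * w + phi y * (w - 1 / y)" by (simp add: algebra_simps)
    also have "norm \<dots> \<le> \<bar>phi v - phi y\<bar> * w + \<bar>phi y\<bar> * (w - 1 / y)"
      using 1 w0 abs_triangle_ineq[of "(phi v - phi y) * w" "phi y * (w - 1 / y)"] by (simp add: abs_mult)
    also have "\<dots> \<le> (M / t) * w + (L / 2) * (1 / t)"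
      using osc[of y] y' 1 2 w0 assms
      by (intro add_mono mult_mono phi_le) (auto simp: u_def v_def)
    finally show "norm (phi v * w - phi y / y) \<le> (M / t) * w + (L / 2) * (1 / t)" .
  qed (use assms n in \<open>auto simp: w_def\<close>)
  also have "\<dots> = ((M / t) * w + (L / 2) * (1 / t)) * (v - u)" using uv by simp
  also have "\<dots> = M / t / real n + L / 2 / (real n * (real n + 1))"
  proof -
    have 1: "w * (v - u) = 1 / real n" "1 / t * (v - u) = 1 / (real n * (real n + 1))"
      unfolding len w_def using n assms(1) by (simp_all add: divide_simps)
    have "((M / t) * w + (L / 2) * (1 / t)) * (v - u)
        = (M / t) * (w * (v - u)) + (L / 2) * (1 / t * (v - u))" by (simp only: distrib_right mult.assoc)
    then show ?thesis unfolding 1 by simp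
  qed
  \<comment> \<open>One factor \<open>n\<close> is given up for \<open>t <= n\<close>, which puts
    the term in the same form as the first.\<close>
  also have "L / 2 / (real n * (real n + 1)) \<le> L / (t * real n)"
    using n assms by (intro frac_le) auto
  finally show ?thesis using n assms by (simp add: add_divide_distrib)
qed

text \<open>Both bounds rest on \<open>L >= 2\<close> and serve to absorb numerical constants into
  multiples of \<open>ln L\<close>.\<close>

lemma ln_L: "1 / 2 \<le> ln L" "ln 4 \<le> 2 * ln L"
proof -
  have "ln 2 \<le> ln L" using L_ge_2 by (intro ln_mono) auto
  moreover have "ln (2 ^ 2 :: real) = 2 * ln 2" by (subst ln_realpow) auto
  moreover have "2 / 3 \<le> ln (2::real)" by (rule ln2_ge_two_thirds)
  ultimately show "1 / 2 \<le> ln L" "ln 4 \<le> 2 * ln L" by auto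
qed

text \<open>The trivial error bound gives \<open>c = L\<close>, and \<open>R = L ^ 4\<close> reduces
  the tail term \<open>8 * D / sqrt R\<close> to \<open>16 * L\<close>, as
  \<open>D = 2 * L ^ 3\<close>. Then \<open>6 * ln L + 17 <= 40 * ln L\<close>.\<close>

lemma abs_H_uniform:
  assumes t: "1 \<le> m" "real m < t" "t < real m + 1"
  shows "\<bar>H m t\<bar> \<le> 40 * L * ln L"
proof -
  have L4: "2 \<le> L ^ 4"
  proof -
    have "(2::real) ^ 4 \<le> L ^ 4" using L_ge_2 by (intro power_mono) auto
    then show ?thesis by simp
  qed
  have "\<bar>H m t\<bar> \<le> L * ln (4 * L ^ 4) + L / (2 * t) + 8 * D / sqrt (L ^ 4)"
    by (intro abs_H_le t L4 abs_err_le) (use t in auto)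
  also have "sqrt (L ^ 4) = L\<^sup>2" by (intro real_sqrt_unique) auto
  also have "8 * D / L\<^sup>2 = 16 * L"
    using L_ge_2 by (simp add: D_def power2_eq_square power3_eq_cube)
  also have "ln (4 * L ^ 4) = ln 4 + 4 * ln L"
    using L_ge_2 by (simp add: ln_mult ln_realpow)
  also have "L * (ln 4 + 4 * ln L) \<le> L * (6 * ln L)"
    using ln_L by (intro mult_left_mono) auto
  also have "L / (2 * t) \<le> L / 1" using t by (intro divide_left_mono) auto
  finally have "\<bar>H m t\<bar> \<le> L * (6 * ln L + 17)" by (simp add: algebra_simps)
  also have "\<dots> \<le> L * (40 * ln L)" using ln_L by (intro mult_left_mono) auto
  finally show ?thesis by simp
qed

text \<open>This is \<open>L\<close> times the uniform bound for \<open>H\<close>, hence a Lipschitz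
  constant for \<open>phi (1 / t)\<close> as a function of \<open>t\<close>.\<close>

definition M :: real where "M = 40 * L\<^sup>2 * ln L"

lemma M_nonneg: "0 \<le> M"
  using ln_L by (simp add: M_def)

text \<open>Away from integers the derivative \<open>lam * H\<close> is bounded by \<open>M\<close>;
  continuity of \<open>phi\<close> carries the fundamental theorem across the finitely many integers
  in the interval.\<close>

lemma phi_lipschitz:
  assumes "1 \<le> a" "a \<le> b"
  shows "\<bar>phi (1 / b) - phi (1 / a)\<bar> \<le> M * (b - a)"
proof -
  define S where "S = real ` {..nat \<lceil>b\<rceil>}"
  have finS: "finite S" by (simp add: S_def)
  define p' where "p' x = lam * H (nat \<lfloor>x\<rfloor>) x" for x
  have fl: "1 \<le> nat \<lfloor>x\<rfloor>" "real (nat \<lfloor>x\<rfloor>) < x" "x < real (nat \<lfloor>x\<rfloor>) + 1"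
    if x: "x \<in> {a..b} - S" for x
  proof -
    have "x \<noteq> real n" for n
    proof
      assume "x = real n"
      then have "n \<le> nat \<lceil>b\<rceil>" using x by (simp, linarith)
      then show False using x \<open>x = real n\<close> by (auto simp: S_def)
    qed
    then have "x \<notin> range real" by auto
    moreover have "1 \<le> x" using x assms by auto
    ultimately show "1 \<le> nat \<lfloor>x\<rfloor>" "real (nat \<lfloor>x\<rfloor>) < x" "x < real (nat \<lfloor>x\<rfloor>) + 1"
      using nat_floor_bounds by blast+
  qed
  have "(p' has_integral (phi (1 / b) - phi (1 / a))) {a..b}"
  proof (rule fundamental_theorem_of_calculus_interior_strong[OF finS assms(2)])
    fix x assume "x \<in> {a<..<b} - S"
    then have x: "x \<in> {a..b} - S" by auto
    show "((\<lambda>x. phi (1 / x)) has_vector_derivative p' x) (at x)"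
      using phi_inverse_deriv[OF fl[OF x]]
      by (simp add: p'_def has_real_derivative_iff_has_vector_derivative)
  next
    show "continuous_on {a..b} (\<lambda>x. phi (1 / x))"
      using assms by (intro continuous_on_compose2[OF phi_continuous] continuous_intros) auto
  qed
  then have "norm (phi (1 / b) - phi (1 / a)) \<le> M * measure lborel {a..b}"
  proof (rule has_integral_bound_real[OF M_nonneg finS])
    fix x assume x: "x \<in> {a..b} - S"
    have "L * \<bar>H (nat \<lfloor>x\<rfloor>) x\<bar> \<le> L * (40 * L * ln L)"
      by (intro mult_left_mono abs_H_uniform fl[OF x]) auto
    then show "norm (p' x) \<le> M"
      by (simp add: p'_def abs_mult L_def[symmetric] M_def power2_eq_square)
  qed
  then show ?thesis using assms by simp
qed

text \<open>The second pass: over one mesh interval \<open>1 / y\<close> moves by at most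
  \<open>1 / t\<close>, so the Lipschitz estimate bounds the oscillation of \<open>phi\<close> by
  \<open>M / t\<close>, and the mesh errors gain a factor \<open>1 / t\<close> up to
  constants.\<close>

lemma abs_H_decay:
  assumes t: "1 \<le> m" "real m < t" "t < real m + 1"
  shows "\<bar>H m t\<bar> \<le> ((L + M) * ln (4 * (t\<^sup>2 * L ^ 4)) + 17 * L) / t"
proof -
  have t1: "1 \<le> t" using t by linarith
  have L4: "2 \<le> t\<^sup>2 * L ^ 4"
  proof -
    have "1 * (2::real) ^ 4 \<le> t\<^sup>2 * L ^ 4" using L_ge_2 t1 by (intro mult_mono power_mono) auto
    then show ?thesis by simp
  qed
  \<comment> \<open>The factor \<open>t^2\<close> in \<open>R\<close> lets the tail term fall like
    \<open>1 / t\<close> too, at the price of \<open>ln t\<close> in the logarithm.\<close>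
  have "\<bar>H m t\<bar> \<le> (L + M) / t * ln (4 * (t\<^sup>2 * L ^ 4)) + L / (2 * t) + 8 * D / sqrt (t\<^sup>2 * L ^ 4)"
  proof (intro abs_H_le t L4)
    show "0 \<le> (L + M) / t" using M_nonneg t1 by simp
    fix n assume n: "m + 1 \<le> n"
    then have n': "t \<le> real n" using t by linarith
    show "\<bar>err t n\<bar> \<le> (L + M) / t / real n"
    proof (rule abs_err_le_osc[OF t1 n' M_nonneg])
      fix y assume y: "t / (real n + 1) \<le> y" "y \<le> t / real n"
      have "0 < t / (real n + 1)" using t1 by simp
      then have y0: "0 < y" using y by linarith
      have 1: "real n / t \<le> 1 / y" "1 / y \<le> (real n + 1) / t"
        using y y0 t1 n' by (auto simp: field_simps)
      have "\<bar>phi (1 / (1 / y)) - phi (1 / (real n / t))\<bar> \<le> M * (1 / y - real n / t)"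
        using 1 n' t1 by (intro phi_lipschitz) auto
      also have "\<dots> \<le> M * (1 / t)"
        using 1 M_nonneg by (intro mult_left_mono) (auto simp: add_divide_distrib)
      finally show "\<bar>phi (t / real n) - phi y\<bar> \<le> M / t" by (simp add: abs_minus_commute)
    qed
  qed
  also have "sqrt (t\<^sup>2 * L ^ 4) = t * L\<^sup>2"
    using t1 by (intro real_sqrt_unique) (auto simp: power_mult_distrib)
  also have "8 * D / (t * L\<^sup>2) = 16 * L / t"
    using L_ge_2 by (simp add: D_def power2_eq_square power3_eq_cube)
  also have "L / (2 * t) \<le> L / t" using t1 by (intro divide_left_mono) auto
  finally have "\<bar>H m t\<bar> \<le> (L + M) / t * ln (4 * (t\<^sup>2 * L ^ 4)) + L / t + 16 * L / t" by simp
  also have "\<dots> = ((L + M) * ln (4 * (t\<^sup>2 * L ^ 4)) + 17 * L) / t"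
    by (simp add: add_divide_distrib[symmetric])
  finally show ?thesis .
qed

section \<open>Pointwise bounds for \<open>x * deriv phi x\<close> and an integrable
  majorant\<close>

text \<open>The point \<open>1 / T\<close> is where the two bounds for \<open>x * deriv phi x\<close> balance.\<close>

definition T :: real where "T = L * ln L"

lemma T_ge_1: "1 \<le> T"
proof -
  have "2 * (1/2) \<le> L * ln L" using L_ge_2 ln_L by (intro mult_mono) auto
  then show ?thesis by (simp add: T_def)
qed

text \<open>The index \<open>n = 0\<close> contributes the junk value \<open>1 / 0 = 0\<close>, which is in the set anyway.\<close>

definition breaks :: "real set" where "breaks = insert 0 (range (\<lambda>n::nat. 1 / real n))"

lemma countable_breaks: "countable breaks"
  by (simp add: breaks_def)

lemma floor_inverse:
  assumes "x \<in> {0..1} - breaks"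
  shows "1 \<le> nat \<lfloor>1 / x\<rfloor>" "real (nat \<lfloor>1 / x\<rfloor>) < 1 / x" "1 / x < real (nat \<lfloor>1 / x\<rfloor>) + 1"
proof -
  have x: "0 < x" "x \<le> 1" using assms by (auto simp: breaks_def)
  have "1 / x \<noteq> real n" for n
  proof
    assume "1 / x = real n"
    then have "x = 1 / real n" by (simp flip: \<open>1 / x = real n\<close>)
    then show False using assms unfolding breaks_def by blast
  qed
  then have "1 / x \<notin> range real" by auto
  then show "1 \<le> nat \<lfloor>1 / x\<rfloor>" "real (nat \<lfloor>1 / x\<rfloor>) < 1 / x" "1 / x < real (nat \<lfloor>1 / x\<rfloor>) + 1"
    using nat_floor_bounds[of "1 / x"] x by auto
qed

lemma phi_has_derivative:
  assumes "x \<in> {0..1} - breaks"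
  shows "(phi has_real_derivative - (lam * H (nat \<lfloor>1 / x\<rfloor>) (1 / x)) / x\<^sup>2) (at x)"
proof -
  have x: "0 < x" using assms by (auto simp: breaks_def)
  have "((\<lambda>x::real. 1 / x) has_real_derivative - 1 / x\<^sup>2) (at x)"
    using x by (auto intro!: derivative_eq_intros simp: power2_eq_square)
  from DERIV_chain2[OF phi_inverse_deriv[OF floor_inverse[OF assms]] this]
  show ?thesis by simp
qed

text \<open>The chain rule for \<open>1 / x\<close> brings in \<open>1 / x^2\<close>, of which the
  weight \<open>x\<close> cancels one power.\<close>

lemma weighted_deriv_eq:
  assumes "x \<in> {0..1} - breaks"
  shows "\<bar>x * deriv phi x\<bar> = L * \<bar>H (nat \<lfloor>1 / x\<rfloor>) (1 / x)\<bar> / x"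
proof -
  have x: "0 < x" using assms by (auto simp: breaks_def)
  show ?thesis
    using DERIV_imp_deriv[OF phi_has_derivative[OF assms]] x
    by (simp add: abs_mult L_def power2_eq_square)
qed

text \<open>This is the uniform bound for \<open>H\<close>, squared. It holds down to 0 but is not
  integrable there.\<close>

lemma weighted_deriv_le_large:
  assumes "x \<in> {0..1} - breaks"
  shows "(x * deriv phi x)\<^sup>2 \<le> 1600 * L ^ 4 * (ln L)\<^sup>2 / x\<^sup>2"
proof -
  have x: "0 < x" using assms by (auto simp: breaks_def)
  have "\<bar>x * deriv phi x\<bar> \<le> L * (40 * L * ln L) / x"
    unfolding weighted_deriv_eq[OF assms]
    using x by (intro divide_right_mono mult_left_mono abs_H_uniform floor_inverse assms) auto
  then have "\<bar>x * deriv phi x\<bar>\<^sup>2 \<le> (L * (40 * L * ln L) / x)\<^sup>2" by (rule power_mono) simp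
  also have "\<dots> = 1600 * L ^ 4 * (ln L)\<^sup>2 / x\<^sup>2"
    by (simp add: power_divide power_mult_distrib power4_eq_xxxx power2_eq_square)
  finally show ?thesis by simp
qed

text \<open>The decay of \<open>H\<close> cancels the factor \<open>1 / x\<close> and leaves
  \<open>L ^ 3 * (ln L)^2\<close>, up to a logarithm of \<open>t\<close> that a small power of
  \<open>t / T\<close> absorbs.\<close>

lemma weighted_deriv_le_small:
  assumes "x \<in> {0..1} - breaks" "x < 1 / T"
  shows "(x * deriv phi x)\<^sup>2 \<le> 1210000 * L ^ 6 * ln L ^ 4 * (x * T) powr (-1/2)"
proof -
  define l where "l = ln L"
  define t where "t = 1 / x"
  \<comment> \<open>The exponent 1/4 makes \<open>ln (t / T) = 4 * ln w <= 4 * w\<close>, while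
    \<open>w^2 = (x * T) powr (-1/2)\<close> is still integrable at 0.\<close>
  define w where "w = (t / T) powr (1/4)"
  have l: "1/2 \<le> l" "ln 4 \<le> 2 * l" using ln_L by (auto simp: l_def)
  have x: "0 < x" using assms by (auto simp: breaks_def)
  have T: "1 \<le> T" "T = L * l" using T_ge_1 by (auto simp: T_def l_def)
  have t: "0 < t" "T < t" using x assms T by (auto simp: t_def field_simps)
  have w1: "1 \<le> w" unfolding w_def using t T by (intro ge_one_powr_ge_zero) auto
  have lnT: "ln T \<le> 2 * l"
  proof -
    have "ln T = l + ln l" using T L_ge_2 l by (simp add: ln_mult l_def)
    also have "ln l \<le> l - 1" using l by (intro ln_le_minus_one) auto
    finally show ?thesis by simp
  qed
  have lnt: "ln t \<le> 2 * l + 4 * w"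
  proof -
    have "ln w = 1/4 * (ln t - ln T)" using t T(1) by (simp add: w_def ln_powr ln_div)
    then have "ln t = ln T + 4 * ln w" by simp
    also have "\<dots> \<le> 2 * l + 4 * w"
      using lnT w1 ln_le_minus_one[of w] by (intro add_mono mult_left_mono) auto
    finally show ?thesis .
  qed
  have "ln (4 * (t\<^sup>2 * L ^ 4)) = ln 4 + 2 * ln t + 4 * l"
    using t L_ge_2 by (simp add: ln_mult ln_realpow l_def)
  also have "\<dots> \<le> 10 * l + 8 * w" using lnt l by linarith
  also have "\<dots> \<le> 10 * (l * w) + 16 * (l * w)"
    using mult_left_mono[OF w1, of l] mult_right_mono[OF l(1), of w] w1 l by (intro add_mono) auto
  finally have ln1: "ln (4 * (t\<^sup>2 * L ^ 4)) \<le> 26 * (l * w)" by simp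
  have LT: "L \<le> L\<^sup>2 * l" using mult_left_mono[OF T(1), of L] T(2) by (simp add: power2_eq_square)
  then have LM: "L + M \<le> 41 * L\<^sup>2 * l" by (simp add: M_def l_def mult_ac)
  have L17: "17 * L \<le> 34 * L\<^sup>2 * l\<^sup>2 * w"
  proof -
    have "L \<le> 2 * (L * l)" using mult_left_mono[OF l(1), of L] by simp
    also have "L * l \<le> (L * l) * (L * l)" using mult_left_mono[OF T(1), of T] T by simp
    finally have 1: "17 * L \<le> 34 * L\<^sup>2 * l\<^sup>2" by (simp add: power2_eq_square mult_ac)
    also have "\<dots> \<le> 34 * L\<^sup>2 * l\<^sup>2 * w" using mult_left_mono[OF w1, of "34 * L\<^sup>2 * l\<^sup>2"] by simp
    finally show ?thesis .
  qed
  have "(L + M) * ln (4 * (t\<^sup>2 * L ^ 4)) \<le> (L + M) * (26 * (l * w))"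
    using ln1 M_nonneg by (intro mult_left_mono) auto
  also have "\<dots> \<le> 41 * L\<^sup>2 * l * (26 * (l * w))"
    using LM l w1 by (intro mult_right_mono) auto
  finally have "(L + M) * ln (4 * (t\<^sup>2 * L ^ 4)) + 17 * L \<le> 41 * L\<^sup>2 * l * (26 * (l * w)) + 34 * L\<^sup>2 * l\<^sup>2 * w"
    using L17 by linarith
  \<comment> \<open>The constant is \<open>41 * 26 + 34\<close>; its square is the 1210000 of the
    conclusion.\<close>
  also have "\<dots> = 1100 * L\<^sup>2 * l\<^sup>2 * w" by (simp add: power2_eq_square)
  finally have num: "(L + M) * ln (4 * (t\<^sup>2 * L ^ 4)) + 17 * L \<le> 1100 * L\<^sup>2 * l\<^sup>2 * w" .
  have "\<bar>H (nat \<lfloor>1 / x\<rfloor>) t\<bar> \<le> ((L + M) * ln (4 * (t\<^sup>2 * L ^ 4)) + 17 * L) / t"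
    unfolding t_def by (intro abs_H_decay floor_inverse assms)
  also have "\<dots> \<le> (1100 * L\<^sup>2 * l\<^sup>2 * w) / t" using num t by (intro divide_right_mono) auto
  also have "\<dots> = 1100 * L\<^sup>2 * l\<^sup>2 * w * x" by (simp add: t_def)
  finally have "L * \<bar>H (nat \<lfloor>1 / x\<rfloor>) (1 / x)\<bar> / x \<le> L * (1100 * L\<^sup>2 * l\<^sup>2 * w * x) / x"
    using x by (intro divide_right_mono mult_left_mono) (auto simp: t_def)
  then have "\<bar>x * deriv phi x\<bar> \<le> 1100 * L ^ 3 * l\<^sup>2 * w"
    unfolding weighted_deriv_eq[OF assms(1)] using x
    by (simp add: power2_eq_square power3_eq_cube mult_ac)
  then have "\<bar>x * deriv phi x\<bar>\<^sup>2 \<le> (1100 * L ^ 3 * l\<^sup>2 * w)\<^sup>2" by (rule power_mono) simp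
  also have "\<dots> = 1210000 * L ^ 6 * l ^ 4 * w\<^sup>2" by (simp add: power_mult_distrib flip: power_mult)
  also have "w\<^sup>2 = (x * T) powr (-1/2)"
  proof -
    have "w\<^sup>2 = w powr 2" using w1 by simp
    also have "\<dots> = (t / T) powr (1/2)" by (simp add: w_def powr_powr)
    also have "t / T = 1 / (x * T)" by (simp add: t_def)
    also have "(1 / (x * T)) powr (1/2) = (x * T) powr (-1/2)"
      using x T(1) by (simp add: powr_divide powr_minus_divide)
    finally show ?thesis .
  qed
  finally show ?thesis by (simp add: l_def)
qed

definition majorant :: "real \<Rightarrow> real" where
  "majorant x = (if x < 1 / T then 1210000 * L ^ 6 * ln L ^ 4 * (x * T) powr (-1/2)
                 else 1600 * L ^ 4 * (ln L)\<^sup>2 / x\<^sup>2)"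

lemma majorant_nonneg: "0 \<le> majorant x"
  using ln_L by (auto simp: majorant_def)

text \<open>The left part integrates to \<open>2 * c2 / T\<close> and the right part to less than
  \<open>c1 * T\<close>. For \<open>T = L * ln L\<close> both are multiples of
  \<open>L ^ 5 * ln L ^ 3\<close>, with coefficients 2420000 and 1600.\<close>

lemma majorant_has_integral:
  "\<exists>i. (majorant has_integral i) {0..1} \<and> i \<le> 2421600 * L ^ 5 * ln L ^ 3"
proof -
  define d where "d = 1 / T"
  have d: "0 < d" "d \<le> 1" using T_ge_1 by (auto simp: d_def)
  define c1 where "c1 = 1600 * L ^ 4 * (ln L)\<^sup>2"
  define c2 where "c2 = 1210000 * L ^ 6 * ln L ^ 4"
  have "((\<lambda>x. x powr (-1/2)) has_integral (d powr (-1/2 + 1) / (-1/2 + 1))) {0..d}"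
    using d by (intro has_integral_powr_from_0) auto
  then have "((\<lambda>x. c2 * T powr (-1/2) * x powr (-1/2)) has_integral c2 * T powr (-1/2) * (d powr (-1/2 + 1) / (-1/2 + 1))) {0..d}"
    by (rule has_integral_mult_right)
  also have "c2 * T powr (-1/2) * (d powr (-1/2 + 1) / (-1/2 + 1)) = 2 * c2 / T"
  proof -
    have "T powr (-1/2) * d powr (1/2) = 1 / T"
      using T_ge_1 by (simp add: d_def powr_minus powr_divide powr_half_sqrt field_simps)
    then have "c2 * (T powr (-1/2) * d powr (1/2)) * 2 = c2 * (1 / T) * 2" by simp
    then show ?thesis by (simp add: mult_ac)
  qed
  \<comment> \<open>At \<open>d = 1 / T\<close> itself the majorant takes its other branch.\<close>
  finally have "(majorant has_integral 2 * c2 / T) {0..d}"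
  proof (rule has_integral_spike_finite[of "{d}", rotated 2])
    fix x assume "x \<in> {0..d} - {d}"
    then show "majorant x = c2 * T powr (-1/2) * x powr (-1/2)"
      using T_ge_1 by (auto simp: majorant_def d_def c2_def powr_mult)
  qed simp
  moreover have "(majorant has_integral c1 * (T - 1)) {d..1}"
  proof -
    have "((\<lambda>x. 1 / x\<^sup>2) has_integral (- 1 / 1) - (- 1 / d)) {d..1}"
    proof (rule fundamental_theorem_of_calculus[OF d(2)])
      fix x assume "x \<in> {d..1}"
      then have x: "0 < x" using d by auto
      have "((\<lambda>x::real. - 1 / x) has_real_derivative 1 / x\<^sup>2) (at x)"
        using x by (auto intro!: derivative_eq_intros simp: power2_eq_square)
      then show "((\<lambda>x. - 1 / x) has_vector_derivative 1 / x\<^sup>2) (at x within {d..1})"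
        by (simp add: has_real_derivative_iff_has_vector_derivative has_vector_derivative_at_within)
    qed
    then have "((\<lambda>x. c1 * (1 / x\<^sup>2)) has_integral c1 * ((- 1 / 1) - (- 1 / d))) {d..1}"
      by (rule has_integral_mult_right)
    then have "((\<lambda>x. c1 * (1 / x\<^sup>2)) has_integral c1 * (T - 1)) {d..1}"
      using T_ge_1 by (simp add: d_def)
    then show ?thesis
      by (rule has_integral_eq[rotated]) (auto simp: majorant_def d_def c1_def)
  qed
  ultimately have "(majorant has_integral 2 * c2 / T + c1 * (T - 1)) {0..1}"
    using d by (intro has_integral_combine[of 0 d 1]) auto
  moreover have "2 * c2 / T + c1 * (T - 1) \<le> 2 * c2 / T + c1 * T"
    by (intro add_left_mono mult_left_mono) (auto simp: c1_def)
  moreover have "2 * c2 / T = 2420000 * L ^ 5 * ln L ^ 3"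
    using L_ge_2 ln_L unfolding c2_def T_def by (simp add: field_simps power_Suc[symmetric] eval_nat_numeral)
  moreover have "c1 * T = 1600 * L ^ 5 * ln L ^ 3"
    by (simp add: c1_def T_def eval_nat_numeral)
  ultimately show ?thesis by (intro exI conjI) auto
qed

section \<open>Differentiability almost everywhere, measurability and the integral bound\<close>

lemma AE_not_breaks: "AE x in lebesgue. x \<notin> breaks"
  by (intro AE_not_in null_sets_completionI countable_imp_null_set_lborel countable_breaks)

lemma phi_AE_differentiable:
  "AE x in lebesgue. x \<in> {0<..<1} \<longrightarrow> phi differentiable (at x)"
  using AE_not_breaks
proof eventually_elim
  case (elim x)
  then show ?case
    using phi_has_derivative[of x] real_differentiable_def by auto
qed

text \<open>Off \<open>breaks\<close> the derivative is a limit of difference quotients of a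
  continuous function; on \<open>breaks\<close>, where \<open>deriv\<close> may be arbitrary,
  countability suffices.\<close>

lemma weighted_deriv_measurable:
  "set_borel_measurable lebesgue {0..1} (\<lambda>x. x * deriv phi x)"
proof -
  \<comment> \<open>Clamping the argument gives a continuous extension: nothing is known of
    \<open>phi\<close> outside \<open>[0, 1]\<close>, and \<open>x + 1 / (n + 1)\<close> may lie
    there.\<close>
  define psi where "psi x = phi (max 0 (min 1 x))" for x
  have "continuous_on UNIV psi"
    unfolding psi_def
    by (intro continuous_on_compose2[OF phi_continuous] continuous_intros) auto
  then have psi [measurable]: "psi \<in> borel_measurable borel"
    by (rule borel_measurable_continuous_onI)
  define E where "E = {0..1} - breaks"
  have "breaks \<in> sets borel" by (rule sets.countable[OF _ countable_breaks]) auto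
  then have E [measurable]: "E \<in> sets borel" by (simp add: E_def)
  define q where "q n x = (psi (x + 1 / real (Suc n)) - psi x) / (1 / real (Suc n))" for n x
  have "(\<lambda>x. indicator E x * (x * deriv phi x)) \<in> borel_measurable borel"
  proof (rule borel_measurable_LIMSEQ_real)
    show "(\<lambda>x. indicator E x * (x * q n x)) \<in> borel_measurable borel" for n
      unfolding q_def by measurable
    fix x :: real
    show "(\<lambda>n. indicator E x * (x * q n x)) \<longlonglongrightarrow> indicator E x * (x * deriv phi x)"
    proof (cases "x \<in> E")
      case True
      \<comment> \<open>Thus \<open>x\<close> is an interior point, near which \<open>psi\<close>
        and \<open>phi\<close> coincide.\<close>
      have "1 \<in> breaks" unfolding breaks_def by (auto intro: image_eqI[of _ _ 1])
      with True have "x \<noteq> 1" by (auto simp: E_def)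
      then have x: "0 < x" "x < 1" using True by (auto simp: E_def breaks_def)
      have "(phi has_real_derivative deriv phi x) (at x)"
        using phi_has_derivative[of x] True DERIV_imp_deriv by (fastforce simp: E_def)
      then have "(psi has_real_derivative deriv phi x) (at x)"
        by (rule has_field_derivative_transform_within_open[of _ _ _ "{0<..<1}"])
           (use x in \<open>auto simp: psi_def\<close>)
      then have lim: "((\<lambda>h. (psi (x + h) - psi x) / h) \<longlongrightarrow> deriv phi x) (at 0)"
        by (simp add: DERIV_def)
      have "filterlim (\<lambda>n. 1 / real (Suc n)) (at 0) sequentially"
        using LIMSEQ_Suc[OF lim_1_over_n] by (auto simp: filterlim_at)
      from filterlim_compose[OF lim this] have "(\<lambda>n. q n x) \<longlonglongrightarrow> deriv phi x"
        by (simp add: q_def)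
      then show ?thesis by (intro tendsto_intros)
    qed simp
  qed
  then have "(\<lambda>x. indicator {0..1} x *\<^sub>R (x * deriv phi x)) \<in> borel_measurable borel"
    by (rule measurable_discrete_difference[OF _ countable_breaks])
       (auto simp: E_def indicator_def)
  then show ?thesis
    unfolding set_borel_measurable_def by (intro measurable_completion) simp
qed

lemma weighted_deriv_le_majorant:
  assumes "x \<in> {0..1} - breaks"
  shows "(x * deriv phi x)\<^sup>2 \<le> majorant x"
  using weighted_deriv_le_large[OF assms] weighted_deriv_le_small[OF assms]
  by (auto simp: majorant_def)

lemma weighted_deriv_square_integral:
  shows "set_integrable lebesgue {0..1} (\<lambda>x. (x * deriv phi x)\<^sup>2)"
    and "(LINT x:{0..1}|lebesgue. (x * deriv phi x)\<^sup>2) \<le> 2421600 * L ^ 5 * ln L ^ 3"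
proof -
  obtain i where i: "(majorant has_integral i) {0..1}" "i \<le> 2421600 * L ^ 5 * ln L ^ 3"
    using majorant_has_integral by blast
  \<comment> \<open>For a nonnegative function gauge integrability already gives Lebesgue
    integrability.\<close>
  have maj: "set_integrable lebesgue {0..1} majorant"
    using i(1) majorant_nonneg by (intro nonnegative_absolutely_integrable_1) auto
  have ae: "AE x in lebesgue. indicator {0..1} x *\<^sub>R (x * deriv phi x)\<^sup>2 \<le> indicator {0..1} x *\<^sub>R majorant x"
    using AE_not_breaks
    by eventually_elim (use weighted_deriv_le_majorant in \<open>auto simp: indicator_def\<close>)
  have "(\<lambda>x. (indicator {0..1} x *\<^sub>R (x * deriv phi x))\<^sup>2) \<in> borel_measurable lebesgue"
    using weighted_deriv_measurable unfolding set_borel_measurable_def by measurable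
  also have "(\<lambda>x. (indicator {0..1} x *\<^sub>R (x * deriv phi x))\<^sup>2)
      = (\<lambda>x. indicator {0..1} x *\<^sub>R (x * deriv phi x)\<^sup>2)"
    by (auto simp: fun_eq_iff indicator_def)
  finally have meas: "(\<lambda>x. indicator {0..1} x *\<^sub>R (x * deriv phi x)\<^sup>2) \<in> borel_measurable lebesgue" .
  show int: "set_integrable lebesgue {0..1} (\<lambda>x. (x * deriv phi x)\<^sup>2)"
    unfolding set_integrable_def
  proof (rule Bochner_Integration.integrable_bound[OF maj[unfolded set_integrable_def] meas])
    show "AE x in lebesgue. norm (indicator {0..1} x *\<^sub>R (x * deriv phi x)\<^sup>2) \<le> norm (indicator {0..1} x *\<^sub>R majorant x)"
      using ae by eventually_elim (auto simp: indicator_def majorant_nonneg)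
  qed
  have "(LINT x:{0..1}|lebesgue. (x * deriv phi x)\<^sup>2) \<le> (LINT x:{0..1}|lebesgue. majorant x)"
    unfolding set_lebesgue_integral_def
    by (rule integral_mono_AE[OF int[unfolded set_integrable_def] maj[unfolded set_integrable_def] ae])
  also have "\<dots> = i"
    using set_lebesgue_integral_eq_integral(2)[OF maj] i(1) by (simp add: integral_unique)
  finally show "(LINT x:{0..1}|lebesgue. (x * deriv phi x)\<^sup>2) \<le> 2421600 * L ^ 5 * ln L ^ 3"
    using i(2) by simp
qed

end

section \<open>Application to the members of an orthonormal system\<close>

lemma eig_system_unit_eigenfunction:
  assumes "eig_system I phi lam" "j \<in> I"
  shows "unit_eigenfunction (phi j) (lam j)"
proof
  have "\<forall>j\<in>I. lam j \<noteq> 0 \<and> eigenfun (phi j) (lam j)"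
    using assms(1) unfolding eig_system_def by blast
  then show "eigenfun (phi j) (lam j)" using assms(2) by blast
  have "\<forall>i\<in>I. \<forall>j\<in>I. inner01 (phi i) (phi j) = (if i = j then 1 else 0)"
    using assms(1) unfolding eig_system_def by blast
  then show "inner01 (phi j) (phi j) = 1" using assms(2) by simp
qed

text \<open>One constant serves all systems and indices because the integral bound involves the
  eigenfunction only through \<open>\<bar>lam j\<bar>\<close>. Differentiability almost everywhere
  is what gives \<open>deriv\<close> its meaning under the integral.\<close>

theorem theorem4p11:
  shows "\<exists>C::real > 0. \<forall>I phi lam. eig_system I phi lam \<longrightarrow>
    (\<forall>j\<in>I.
       (AE x in lebesgue. x \<in> {0<..<1} \<longrightarrow> phi j differentiable (at x)) \<and>
       set_borel_measurable lebesgue {0..1} (\<lambda>x. x * deriv (phi j) x) \<and>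
       set_integrable lebesgue {0..1} (\<lambda>x. (x * deriv (phi j) x)\<^sup>2) \<and>
       (LINT x:{0..1}|lebesgue. (x * deriv (phi j) x)\<^sup>2)
         \<le> C * \<bar>lam j\<bar> ^ 5 * (ln \<bar>lam j\<bar>) ^ 3)"
proof (intro exI[of _ 2421600] conjI allI impI ballI)
  fix I phi lam j
  assume "eig_system I phi lam" "j \<in> I"
  then interpret unit_eigenfunction "phi j" "lam j"
    by (rule eig_system_unit_eigenfunction)
  show "AE x in lebesgue. x \<in> {0<..<1} \<longrightarrow> phi j differentiable (at x)"
    by (rule phi_AE_differentiable)
  show "set_borel_measurable lebesgue {0..1} (\<lambda>x. x * deriv (phi j) x)"
    by (rule weighted_deriv_measurable)
  show "set_integrable lebesgue {0..1} (\<lambda>x. (x * deriv (phi j) x)\<^sup>2)"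
    by (rule weighted_deriv_square_integral)
  show "(LINT x:{0..1}|lebesgue. (x * deriv (phi j) x)\<^sup>2)
      \<le> 2421600 * \<bar>lam j\<bar> ^ 5 * (ln \<bar>lam j\<bar>) ^ 3"
    using weighted_deriv_square_integral(2) by (simp only: L_def)
qed simp

end
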